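(* Let $R\ge R_0=\|x^0-x^*\|$ and let $Q=B_{4R}(x^* )$. Assume that - (bounded variance) $\mathbb{E}\|F_\xi(x)-F(x)\|^2\le\sigma^2$ for all $x\in Q$; - (Lipschitzness) $\|F(x)-F(y)\|\le L\|x-y\|$ for all $x,y\in Q$; - (monotonicity) $\langle F(x)-F(y),x-y\rangle\ge0$ for all $x,y\in Q$. Let $\gamma_1=\gamma_2=\gamma$ and $$0<\gamma\le\frac1{160L\ln\frac{6(K+1)}\beta},\qquad \lambda_{1,k}=\lambda_{2,k}\equiv\lambda=\frac R{20\gamma\ln\frac{6(K+1)}\beta},$$ $$m_{1,k}=m_{2,k}\equiv m\ge\max\left\{1,\frac{10800(K+1)\gamma^2\sigma^2\ln\frac{6(K+1)}\beta}{R^2}\right\}$$ for some integer $K\ge0$ and $\beta\in(0,1]$ such that $\ln\frac{6(K+1)}\beta\ge1$. Then, after $K$ iterations, the iterates produced by clipped-SEG satisfy with probability at least $1-\beta$ $$\mathrm{Gap}_R(\widetilde x^K_{\rm avg})\le\frac{9R^2}{2\gamma(K+1)},\qquad\text{where }\widetilde x^K_{\rm avg}=\frac1{K+1}\sum_{k=0}^K\widetilde x^k.$$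
   Context: Notation: $\|\cdot\|$ is the Euclidean norm, $B_r(x)=\{u\in\mathbb{R}^d:\|u-x\|\le r\}$. $F:\mathbb{R}^d\to\mathbb{R}^d$ with $F(x)=\mathbb{E}_{\xi\sim\mathcal D}[F_\xi(x)]$ for all $x$, where $F_\xi(x)$ is a stochastic oracle. $\mathcal X^*=\{x:F(x)=0\}$ is nonempty, $x^0$ is the starting point, $x^*$ is the projection of $x^0$ onto $\mathcal X^*$. $\mathrm{Gap}_R(x)=\max_{y\in B_R(x^* )}\langle F(y),x-y\rangle$. $\mathrm{clip}(y,\lambda)=\min\{1,\lambda/\|y\|\}y$ for $y\ne0$, $\mathrm{clip}(0,\lambda)=0$, for $\lambda>0$. clipped-SEG, for $k=0,1,\dots$: $\widetilde x^k=x^k-\gamma_1\widetilde F_{\boldsymbol\xi_1^k}(x^k)$, $x^{k+1}=x^k-\gamma_2\widetilde F_{\boldsymbol\xi_2^k}(\widetilde x^k)$, where $\widetilde F_{\boldsymbol\xi_1^k}(x^k)=\mathrm{clip}\left(\frac1{m_{1,k}}\sum_{i=1}^{m_{1,k}}F_{\xi_1^{i,k}}(x^k),\lambda_{1,k}\right)$, $\widetilde F_{\boldsymbol\xi_2^k}(\widetilde x^k)=\mathrm{clip}\left(\frac1{m_{2,k}}\sum_{i=1}^{m_{2,k}}F_{\xi_2^{i,k}}(\widetilde x^k),\lambda_{2,k}\right)$ and all $\xi_1^{i,k},\xi_2^{i,k}$ are independent samples from $\mathcal D$. Clipping levels are positive (so $R>0$), batchsizes are positive integers. *)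

theory Defs
  imports "HOL-Probability.Probability"
begin

definition clip :: "'a::real_normed_vector \<Rightarrow> real \<Rightarrow> 'a" where
  "clip y lam = (if y = 0 then 0 else min 1 (lam / norm y) *\<^sub>R y)"

text \<open>\<open>G \<xi> x\<close> is the stochastic oracle at the point \<open>x\<close> with sample \<open>\<xi>\<close>;
  \<open>\<xi>s 1, \<dots>, \<xi>s m\<close> is the minibatch.\<close>

definition clipped_estimate ::
  "('b \<Rightarrow> 'a::real_normed_vector \<Rightarrow> 'a) \<Rightarrow> nat \<Rightarrow> real \<Rightarrow> (nat \<Rightarrow> 'b) \<Rightarrow> 'a \<Rightarrow> 'a" where
  "clipped_estimate G m lam \<xi>s x = clip ((1 / real m) *\<^sub>R (\<Sum>i=1..m. G (\<xi>s i) x)) lam"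

text \<open>The method as a function of one realisation of the samples: \<open>\<xi> s k i\<close>, with
  \<open>s \<in> {1, 2}\<close>, is the \<open>i\<close>-th sample of the first (extrapolation) or second (update)
  minibatch of iteration \<open>k\<close>. The two functions below return \<open>x\<^sup>k\<close> and the
  extrapolated point used in iteration \<open>k\<close>.\<close>

primrec clipped_SEG ::
  "('b \<Rightarrow> 'a::real_normed_vector \<Rightarrow> 'a) \<Rightarrow> 'a \<Rightarrow> real \<Rightarrow> real \<Rightarrow> (nat \<Rightarrow> real) \<Rightarrow> (nat \<Rightarrow> real)
    \<Rightarrow> (nat \<Rightarrow> nat) \<Rightarrow> (nat \<Rightarrow> nat) \<Rightarrow> (nat \<Rightarrow> nat \<Rightarrow> nat \<Rightarrow> 'b) \<Rightarrow> nat \<Rightarrow> 'a" where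
  "clipped_SEG G x0 \<gamma>1 \<gamma>2 lam1 lam2 m1 m2 \<xi> 0 = x0"
| "clipped_SEG G x0 \<gamma>1 \<gamma>2 lam1 lam2 m1 m2 \<xi> (Suc k) =
    (let x = clipped_SEG G x0 \<gamma>1 \<gamma>2 lam1 lam2 m1 m2 \<xi> k;
         x' = x - \<gamma>1 *\<^sub>R clipped_estimate G (m1 k) (lam1 k) (\<xi> 1 k) x
     in x - \<gamma>2 *\<^sub>R clipped_estimate G (m2 k) (lam2 k) (\<xi> 2 k) x')"

definition clipped_SEG_tilde ::
  "('b \<Rightarrow> 'a::real_normed_vector \<Rightarrow> 'a) \<Rightarrow> 'a \<Rightarrow> real \<Rightarrow> real \<Rightarrow> (nat \<Rightarrow> real) \<Rightarrow> (nat \<Rightarrow> real)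
    \<Rightarrow> (nat \<Rightarrow> nat) \<Rightarrow> (nat \<Rightarrow> nat) \<Rightarrow> (nat \<Rightarrow> nat \<Rightarrow> nat \<Rightarrow> 'b) \<Rightarrow> nat \<Rightarrow> 'a" where
  "clipped_SEG_tilde G x0 \<gamma>1 \<gamma>2 lam1 lam2 m1 m2 \<xi> k =
    (let x = clipped_SEG G x0 \<gamma>1 \<gamma>2 lam1 lam2 m1 m2 \<xi> k
     in x - \<gamma>1 *\<^sub>R clipped_estimate G (m1 k) (lam1 k) (\<xi> 1 k) x)"

definition clipped_SEG_tilde_avg ::
  "('b \<Rightarrow> 'a::real_normed_vector \<Rightarrow> 'a) \<Rightarrow> 'a \<Rightarrow> real \<Rightarrow> real \<Rightarrow> (nat \<Rightarrow> real) \<Rightarrow> (nat \<Rightarrow> real)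
    \<Rightarrow> (nat \<Rightarrow> nat) \<Rightarrow> (nat \<Rightarrow> nat) \<Rightarrow> (nat \<Rightarrow> nat \<Rightarrow> nat \<Rightarrow> 'b) \<Rightarrow> nat \<Rightarrow> 'a" where
  "clipped_SEG_tilde_avg G x0 \<gamma>1 \<gamma>2 lam1 lam2 m1 m2 \<xi> K =
    (1 / (real K + 1)) *\<^sub>R (\<Sum>k=0..K. clipped_SEG_tilde G x0 \<gamma>1 \<gamma>2 lam1 lam2 m1 m2 \<xi> k)"

text \<open>A nearest point, stated relationally because \<^const>\<open>closest_point\<close> is
  meaningful only when a nearest point exists.\<close>

definition is_projection :: "'a::metric_space set \<Rightarrow> 'a \<Rightarrow> 'a \<Rightarrow> bool" where
  "is_projection S x p \<longleftrightarrow> p \<in> S \<and> (\<forall>y\<in>S. dist x p \<le> dist x y)"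

text \<open>The supremum is a maximum when \<open>F\<close> is continuous on the ball; see
  \<open>Gap_attained\<close>.\<close>

definition Gap :: "('a::real_inner \<Rightarrow> 'a) \<Rightarrow> 'a \<Rightarrow> real \<Rightarrow> 'a \<Rightarrow> real" where
  "Gap F xs R x = (SUP y\<in>cball xs R. F y \<bullet> (x - y))"

lemma Gap_attained:
  fixes F :: "'a::euclidean_space \<Rightarrow> 'a"
  assumes "continuous_on (cball xs R) F" and "R \<ge> 0"
  shows "\<exists>y\<in>cball xs R. Gap F xs R x = F y \<bullet> (x - y) \<and>
    (\<forall>z\<in>cball xs R. F z \<bullet> (x - z) \<le> F y \<bullet> (x - y))"
proof -
  have "continuous_on (cball xs R) (\<lambda>y. F y \<bullet> (x - y))"
    using assms(1) by (intro continuous_intros)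
  then obtain y where y: "y \<in> cball xs R"
      "\<And>z. z \<in> cball xs R \<Longrightarrow> F z \<bullet> (x - z) \<le> F y \<bullet> (x - y)"
    using continuous_attains_sup[of "cball xs R"] assms(2) by fastforce
  then have "Gap F xs R x = F y \<bullet> (x - y)"
    unfolding Gap_def by (intro cSup_eq_maximum) auto
  with y show ?thesis by blast
qed

end

theory Submission
  imports Defs
begin

text \<open>Put \<open>A = ln (6 (K + 1) / \<beta>)\<close>, let \<open>\<theta>\<^sub>k\<close> be the error of the second clipped estimate and
  \<open>p\<^sub>k = \<gamma> (\<theta>\<^sub>0 + \<dots> + \<theta>\<^bsub>k-1\<^esub>)\<close>. The extragradient inequality makes
  \<open>\<parallel>x\<^sup>k - x\<^sup>*\<parallel>\<^sup>2 + \<parallel>p\<^sub>k\<parallel>\<^sup>2\<close> grow by at most a noise increment per step. Adding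
  \<open>\<parallel>p\<^sub>k\<parallel>\<^sup>2\<close> to the usual potential controls the term \<open>\<langle>p\<^sub>k, x\<^sup>* - u\<rangle>\<close>, which must be bounded
  uniformly in \<open>u\<close>, so one scalar process suffices: if \<open>R\<^sup>2\<close> plus the sum of the increments stays
  below \<open>4 R\<^sup>2\<close>, then all iterates lie in the ball \<open>Q\<close> and the gap is at most
  \<open>8 R\<^sup>2 / (2 \<gamma> (K + 1))\<close>. The process is stopped when it exceeds \<open>4 R\<^sup>2\<close>. Until
  then its increments are small enough that
  \<open>exp z \<le> 1 + z + z\<^sup>2\<close> gives a conditional exponential moment of at most \<open>1 + A / (K + 1)\<close> at
  the scale \<open>t = A / R\<^sup>2\<close>. Hence the expectation of \<open>exp (t \<psi>)\<close>, where \<open>\<psi>\<close> is the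
  final value, is at most \<open>exp (2 A)\<close>, and Markov's inequality bounds the failure probability by \<open>exp (- 2 A) \<le> \<beta>\<close>.\<close>

section \<open>Clipping and the extragradient inequality\<close>

lemma norm_clip_le:
  fixes y :: "'a::real_normed_vector"
  assumes "0 < lam" shows "norm (clip y lam) \<le> lam"
proof (cases "norm y \<le> lam")
  case True
  then show ?thesis using assms by (auto simp: clip_def min_def field_simps)
next
  case False
  then have "y \<noteq> 0" using assms by auto
  then show ?thesis using False assms by (auto simp: clip_def min_def abs_mult field_simps)
qed

lemma clip_cases:
  fixes y :: "'a::real_normed_vector"
  assumes "0 < lam"
  obtains "clip y lam = y"
  | s where "lam < norm y" "clip y lam = s *\<^sub>R y" "s * norm y = lam" "0 < s" "s < 1"
proof (cases "norm y \<le> lam")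
  case True
  then have "clip y lam = y" using assms by (auto simp: clip_def min_def field_simps)
  then show ?thesis using that by blast
next
  case False
  then have "y \<noteq> 0" using assms by auto
  then have "clip y lam = (lam / norm y) *\<^sub>R y" using False assms
    by (auto simp: clip_def min_def field_simps)
  moreover have "lam / norm y * norm y = lam" "0 < lam / norm y" "lam / norm y < 1"
    using False assms \<open>y \<noteq> 0\<close> by auto
  ultimately show ?thesis using that(2) False by force
qed

text \<open>\<open>clip\<close> is the projection onto the ball of radius \<open>lam\<close>, which
  contains \<open>a\<close>; projecting onto a convex set does not increase the distance to its
  points.\<close>

lemma norm_clip_diff_le:
  fixes y a :: "'a::real_inner"
  assumes lam: "0 < lam" and a: "norm a \<le> lam"
  shows "norm (clip y lam - a) \<le> norm (y - a)"
  using lam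
proof (cases rule: clip_cases[where y = y and lam = lam])
  case 1
  then show ?thesis by simp
next
  case (2 s)
  have "y \<bullet> a \<le> norm y * norm a" by (rule norm_cauchy_schwarz)
  also have "\<dots> \<le> norm y * lam" using a by (intro mult_left_mono) auto
  also have "\<dots> = s * (norm y)\<^sup>2" using 2 by (simp add: power2_eq_square)
  finally have "2 * (y \<bullet> a) \<le> (1 + s) * (y \<bullet> y)"
    using 2 mult_right_mono[of "2 * s" "1 + s" "(norm y)\<^sup>2"] by (simp add: power2_norm_eq_inner)
  then have "0 \<le> (1 - s) * ((1 + s) * (y \<bullet> y) - 2 * (y \<bullet> a))" using 2 by simp
  also have "\<dots> = (norm (y - a))\<^sup>2 - (norm (clip y lam - a))\<^sup>2"
    unfolding 2 power2_norm_eq_inner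
    by (simp add: algebra_simps inner_commute)
  finally have "(norm (clip y lam - a))\<^sup>2 \<le> (norm (y - a))\<^sup>2" by simp
  then show ?thesis by (rule power2_le_imp_le) simp
qed

text \<open>When active, clipping removes a vector of length \<open>norm y - lam\<close>. With
  \<open>d = norm (y - a)\<close> this is at most \<open>d - lam / 2\<close>, and
  \<open>(d - lam)\<^sup>2 \<ge> 0\<close> turns it into \<open>d\<^sup>2 / (2 * lam)\<close>. A
  second moment thus controls the clipping bias.\<close>

lemma norm_diff_clip_le:
  fixes y a :: "'a::real_inner"
  assumes lam: "0 < lam" and a: "norm a \<le> lam / 2"
  shows "norm (y - clip y lam) \<le> (norm (y - a))\<^sup>2 / (2 * lam)"
  using lam
proof (cases rule: clip_cases[where y = y and lam = lam])
  case 1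
  then show ?thesis using lam by simp
next
  case (2 s)
  have "y - clip y lam = (1 - s) *\<^sub>R y" unfolding 2 by (simp add: algebra_simps)
  then have "norm (y - clip y lam) = (1 - s) * norm y" using 2 by simp
  also have "\<dots> = norm y - lam" using 2 by (simp add: algebra_simps)
  also have "\<dots> \<le> norm (y - a) - lam / 2" using a norm_triangle_sub[of y a] by linarith
  also have "\<dots> \<le> (norm (y - a))\<^sup>2 / (2 * lam)"
    using lam zero_le_power2[of "norm (y - a) - lam"]
    by (simp add: field_simps power2_eq_square)
  finally show ?thesis .
qed

text \<open>For \<open>x = - y < 0\<close> the claim is proved in reciprocal form:
  \<open>1 - y + y\<^sup>2\<close> times the Taylor lower bound of \<open>exp y\<close> is at least
  1.\<close>

lemma exp_le_quadratic:
  fixes x :: real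
  assumes "x \<le> 1" shows "exp x \<le> 1 + x + x\<^sup>2"
proof (cases "0 \<le> x")
  case True
  then show ?thesis using exp_bound assms by blast
next
  case False
  define y where "y = - x"
  have y: "0 < y" using False y_def by simp
  have p: "0 < 1 - y + y\<^sup>2" using zero_le_power2[of "y - 1/2"]
    by (simp add: power2_eq_square algebra_simps)
  have "1 \<le> 1 + y\<^sup>2 / 2 + y^3 / 2 + y^4 / 2" using y by simp
  also have "\<dots> = (1 - y + y\<^sup>2) * (1 + y + y\<^sup>2 / 2)"
    by (simp add: field_simps power2_eq_square power3_eq_cube power4_eq_xxxx)
  also have "\<dots> \<le> (1 - y + y\<^sup>2) * exp y"
    using exp_lower_Taylor_quadratic[of y] y p by (intro mult_left_mono) auto
  finally show ?thesis by (simp add: y_def exp_minus field_simps)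
qed

text \<open>Splitting \<open>\<theta> = (f2 - Y2) + (Y2 - clip Y2 lam)\<close> leaves a term that is linear in \<open>Y2\<close> and has mean
  zero, while the clipping bias is bounded pointwise by \<open>\<parallel>Y2 - f2\<parallel>\<^sup>2\<close>.\<close>

lemma exp_noise_le:
  fixes f1 f2 Y1 Y2 w :: "'a::real_inner"
  assumes A: "A \<ge> 1" and R: "R > 0" and \<gamma>: "\<gamma> > 0" and lam: "lam = R / (20 * \<gamma> * A)"
    and f1: "norm f1 \<le> lam / 2" and f2: "norm f2 \<le> lam / 2" and w: "norm w \<le> 5 * R"
  defines "t \<equiv> A / R\<^sup>2" and "\<theta> \<equiv> f2 - clip Y2 lam" and "\<omega> \<equiv> f1 - clip Y1 lam"
  shows "exp (t * (2 * \<gamma> * (\<theta> \<bullet> w) + \<gamma>\<^sup>2 * (4 * (norm \<theta>)\<^sup>2 + 3 * (norm \<omega>)\<^sup>2)))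
    \<le> 1 + 2 * t * \<gamma> * ((f2 - Y2) \<bullet> w)
        + t * \<gamma>\<^sup>2 * A * (312 * (norm (Y2 - f2))\<^sup>2 + 9 * (norm (Y1 - f1))\<^sup>2)"
proof -
  have lam0: "lam > 0" using assms by simp
  have t0: "t > 0" using A R by (simp add: t_def)
  have \<gamma>lam: "\<gamma> * lam = R / (20 * A)" using \<gamma> lam by simp
  \<comment> \<open>An error has length at most \<open>lam / 2 + lam\<close>, and
    \<open>\<gamma> * lam = R / (20 * A)\<close>.\<close>
  have bound: "\<gamma> * norm (f - clip Y lam) \<le> 3 * R / (40 * A)" if "norm f \<le> lam / 2" for f Y :: 'a
  proof -
    have "norm (f - clip Y lam) \<le> 3 / 2 * lam"
      using norm_triangle_ineq4[of f "clip Y lam"] norm_clip_le[OF lam0, of Y] that by linarith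
    then have "\<gamma> * norm (f - clip Y lam) \<le> \<gamma> * (3 / 2 * lam)" using \<gamma> by (intro mult_left_mono) auto
    also have "\<dots> = 3 / 2 * (\<gamma> * lam)" by simp
    also have "\<dots> = 3 * R / (40 * A)" unfolding \<gamma>lam by simp
    finally show ?thesis .
  qed
  have sq: "t * \<gamma>\<^sup>2 * (norm (f - clip Y lam))\<^sup>2 \<le> 1 / 100" if "norm f \<le> lam / 2" for f Y :: 'a
  proof -
    have "(\<gamma> * norm (f - clip Y lam))\<^sup>2 \<le> (3 * R / (40 * A))\<^sup>2"
      using bound[OF that] \<gamma> by (intro power_mono) auto
    then have "t * (\<gamma> * norm (f - clip Y lam))\<^sup>2 \<le> t * (3 * R / (40 * A))\<^sup>2"
      using t0 by (intro mult_left_mono) auto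
    also have "\<dots> = 9 / (1600 * A)" using A R by (simp add: t_def field_simps power2_eq_square)
    also have "\<dots> \<le> 1 / 100" using A by (simp add: field_simps)
    finally show ?thesis by (simp add: power_mult_distrib mult.assoc)
  qed
  \<comment> \<open>\<open>a\<close> is the linear and \<open>b\<close> the quadratic part of the
    exponent. The bounds 3/4 and 7/100 keep \<open>a + b\<close> below 1, where the quadratic bound
    on \<open>exp\<close> is valid.\<close>
  define a where "a = 2 * t * \<gamma> * (\<theta> \<bullet> w)"
  define b where "b = t * \<gamma>\<^sup>2 * (4 * (norm \<theta>)\<^sup>2 + 3 * (norm \<omega>)\<^sup>2)"
  have b0: "0 \<le> b" unfolding b_def using t0 by simp
  have b1: "b \<le> 7 / 100"
    using sq[OF f2, of Y2] sq[OF f1, of Y1]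
    unfolding b_def \<theta>_def \<omega>_def by (simp add: algebra_simps)
  have aw: "\<bar>\<theta> \<bullet> w\<bar> \<le> norm \<theta> * (5 * R)"
    using Cauchy_Schwarz_ineq2[of \<theta> w] mult_left_mono[OF w, of "norm \<theta>"] by simp
  have "\<bar>a\<bar> = 2 * t * \<gamma> * \<bar>\<theta> \<bullet> w\<bar>" using t0 \<gamma> by (simp add: a_def abs_mult)
  also have "\<dots> \<le> 2 * t * \<gamma> * (norm \<theta> * (5 * R))"
    using aw t0 \<gamma> by (intro mult_left_mono) auto
  also have "\<dots> = 10 * t * R * (\<gamma> * norm \<theta>)" by simp
  finally have a_abs: "\<bar>a\<bar> \<le> 10 * t * R * (\<gamma> * norm \<theta>)" .
  also have "\<dots> \<le> 10 * t * R * (3 * R / (40 * A))"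
    using bound[OF f2, of Y2] t0 R unfolding \<theta>_def by (intro mult_left_mono) auto
  also have "\<dots> = 3 / 4" using A R by (simp add: t_def field_simps power2_eq_square)
  finally have a1: "\<bar>a\<bar> \<le> 3 / 4" .
  \<comment> \<open>Since \<open>t * R\<^sup>2 = A\<close>, the square of the linear part is again a
    multiple of \<open>t * \<gamma>\<^sup>2 * (norm \<theta>)\<^sup>2\<close>, so a variance bounds
    its expectation.\<close>
  have "a\<^sup>2 \<le> (10 * t * R * (\<gamma> * norm \<theta>))\<^sup>2" using power_mono[OF a_abs, of 2] by simp
  also have "\<dots> = 100 * (t * R\<^sup>2) * (t * \<gamma>\<^sup>2 * (norm \<theta>)\<^sup>2)"
    by (simp add: power2_eq_square)
  also have "t * R\<^sup>2 = A" using R by (simp add: t_def)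
  finally have a2: "a\<^sup>2 \<le> 100 * (A * (t * \<gamma>\<^sup>2 * (norm \<theta>)\<^sup>2))" by (simp add: mult.assoc)
  have "(a + b)\<^sup>2 \<le> 2 * a\<^sup>2 + 2 * b\<^sup>2"
    using zero_le_power2[of "a - b"] by (simp add: power2_eq_square algebra_simps)
  also have "b\<^sup>2 \<le> b" using b0 b1 by (simp add: power2_eq_square mult_left_le)
  finally have q: "(a + b)\<^sup>2 \<le> 2 * a\<^sup>2 + 2 * b" by simp
  have "exp (a + b) \<le> 1 + (a + b) + (a + b)\<^sup>2" using a1 b1 by (intro exp_le_quadratic) linarith
  then have e: "exp (a + b) \<le> 1 + a + 2 * a\<^sup>2 + 3 * b" using q by linarith
  have "a = 2 * t * \<gamma> * ((f2 - Y2) \<bullet> w) + 2 * t * \<gamma> * ((Y2 - clip Y2 lam) \<bullet> w)"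
    by (simp add: a_def \<theta>_def algebra_simps)
  \<comment> \<open>The constant 100 obtained here is that of
    \<open>5 * R / lam = 100 * \<gamma> * A\<close>.\<close>
  also have "2 * t * \<gamma> * ((Y2 - clip Y2 lam) \<bullet> w) \<le> 2 * t * \<gamma> * ((norm (Y2 - f2))\<^sup>2 / (2 * lam) * (5 * R))"
  proof (intro mult_left_mono)
    have "(Y2 - clip Y2 lam) \<bullet> w \<le> norm (Y2 - clip Y2 lam) * norm w" by (rule norm_cauchy_schwarz)
    also have "\<dots> \<le> (norm (Y2 - f2))\<^sup>2 / (2 * lam) * (5 * R)"
      using norm_diff_clip_le[OF lam0 f2, of Y2] w lam0 by (intro mult_mono) auto
    finally show "(Y2 - clip Y2 lam) \<bullet> w \<le> (norm (Y2 - f2))\<^sup>2 / (2 * lam) * (5 * R)" .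
  qed (use t0 \<gamma> in auto)
  also have "\<dots> = 100 * (A * (t * \<gamma>\<^sup>2 * (norm (Y2 - f2))\<^sup>2))"
    using R \<gamma> A by (simp add: lam field_simps power2_eq_square)
  finally have a3: "a \<le> 2 * t * \<gamma> * ((f2 - Y2) \<bullet> w) + 100 * (A * (t * \<gamma>\<^sup>2 * (norm (Y2 - f2))\<^sup>2))" by simp
  have cmp: "t * \<gamma>\<^sup>2 * (norm (f - clip Y lam))\<^sup>2 \<le> t * \<gamma>\<^sup>2 * (norm (Y - f))\<^sup>2"
    if "norm f \<le> lam / 2" for f Y :: 'a
    using norm_clip_diff_le[OF lam0, of f Y] that lam0 t0
    by (intro mult_left_mono power_mono) (auto simp: norm_minus_commute)
  \<comment> \<open>The terms of \<open>3 * b\<close> are enlarged by the factor \<open>A\<close> to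
    match those coming from \<open>a\<close>.\<close>
  have mA: "z \<le> A * z" if "0 \<le> z" for z using A that by (simp add: mult_le_cancel_right1)
  have c2: "A * (t * \<gamma>\<^sup>2 * (norm \<theta>)\<^sup>2) \<le> A * (t * \<gamma>\<^sup>2 * (norm (Y2 - f2))\<^sup>2)"
    unfolding \<theta>_def by (rule mult_left_mono[OF cmp[OF f2, of Y2]]) (use A in simp)
  have c1: "A * (t * \<gamma>\<^sup>2 * (norm \<omega>)\<^sup>2) \<le> A * (t * \<gamma>\<^sup>2 * (norm (Y1 - f1))\<^sup>2)"
    unfolding \<omega>_def by (rule mult_left_mono[OF cmp[OF f1, of Y1]]) (use A in simp)
  have "3 * b = 12 * (t * \<gamma>\<^sup>2 * (norm \<theta>)\<^sup>2) + 9 * (t * \<gamma>\<^sup>2 * (norm \<omega>)\<^sup>2)"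
    by (simp add: b_def algebra_simps)
  also have "\<dots> \<le> 12 * (A * (t * \<gamma>\<^sup>2 * (norm \<theta>)\<^sup>2)) + 9 * (A * (t * \<gamma>\<^sup>2 * (norm \<omega>)\<^sup>2))"
    using t0 by (intro add_mono mult_left_mono mA) auto
  finally have b3: "3 * b \<le> \<dots>" .
  have "t * (2 * \<gamma> * (\<theta> \<bullet> w) + \<gamma>\<^sup>2 * (4 * (norm \<theta>)\<^sup>2 + 3 * (norm \<omega>)\<^sup>2)) = a + b"
    by (simp add: a_def b_def algebra_simps)
  \<comment> \<open>312 = 100 + 2 * 100 + 3 * 4, from the bias in \<open>a\<close>, from
    \<open>2 * a\<^sup>2\<close> and from \<open>3 * b\<close>; 9 = 3 * 3 comes from
    \<open>3 * b\<close> alone.\<close>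
  moreover have "1 + a + 2 * a\<^sup>2 + 3 * b \<le> 1 + 2 * t * \<gamma> * ((f2 - Y2) \<bullet> w)
        + (312 * (A * (t * \<gamma>\<^sup>2 * (norm (Y2 - f2))\<^sup>2)) + 9 * (A * (t * \<gamma>\<^sup>2 * (norm (Y1 - f1))\<^sup>2)))"
    using a2 a3 b3 c1 c2 by linarith
  ultimately show ?thesis using e by (simp add: algebra_simps)
qed

text \<open>Writing \<open>x' = x - \<gamma> g\<^sub>1\<close>, the cross term of the update expands as
  \<open>- 2 \<langle>g\<^sub>2, g\<^sub>1\<rangle> + \<parallel>g\<^sub>2\<parallel>\<^sup>2 = \<parallel>g\<^sub>2 - g\<^sub>1\<parallel>\<^sup>2 - \<parallel>g\<^sub>1\<parallel>\<^sup>2\<close>, and the Lipschitz part of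
  \<open>g\<^sub>2 - g\<^sub>1\<close> is absorbed by \<open>\<parallel>g\<^sub>1\<parallel>\<^sup>2\<close>.\<close>

lemma extragradient_step:
  fixes x u g1 g2 f1 f2 :: "'a::real_inner" and \<gamma> :: real
  defines "x' \<equiv> x - \<gamma> *\<^sub>R g1"
  assumes lip: "norm (f2 - f1) \<le> L * norm (x' - x)" and \<gamma>: "3 * (L * \<gamma>)\<^sup>2 \<le> 1"
  shows "(norm (x - \<gamma> *\<^sub>R g2 - u))\<^sup>2 \<le> (norm (x - u))\<^sup>2 - 2 * \<gamma> * (f2 \<bullet> (x' - u))
    + 2 * \<gamma> * ((f2 - g2) \<bullet> (x' - u)) + 3 * \<gamma>\<^sup>2 * ((norm (f2 - g2))\<^sup>2 + (norm (f1 - g1))\<^sup>2)"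
proof -
  have tri: "(norm (p + q + r))\<^sup>2 \<le> 3 * (norm p)\<^sup>2 + 3 * (norm q)\<^sup>2 + 3 * (norm r)\<^sup>2" for p q r :: 'a
  proof -
    have "(norm (p + q + r))\<^sup>2 + (norm (p - q))\<^sup>2 + (norm (q - r))\<^sup>2 + (norm (p - r))\<^sup>2
       = 3 * (norm p)\<^sup>2 + 3 * (norm q)\<^sup>2 + 3 * (norm r)\<^sup>2"
      by (simp add: power2_norm_eq_inner algebra_simps inner_commute)
    then show ?thesis using zero_le_power2[of "norm (p - q)"] zero_le_power2[of "norm (q - r)"]
        zero_le_power2[of "norm (p - r)"] by linarith
  qed
  have "norm (f2 - f1) \<le> L * (\<bar>\<gamma>\<bar> * norm g1)" using lip by (simp add: x'_def)
  then have "(norm (f2 - f1))\<^sup>2 \<le> (L * (\<bar>\<gamma>\<bar> * norm g1))\<^sup>2" by (intro power_mono) auto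
  also have "\<dots> = (L * \<gamma>)\<^sup>2 * (norm g1)\<^sup>2" by (simp add: power_mult_distrib)
  finally have "3 * (norm (f2 - f1))\<^sup>2 \<le> (norm g1)\<^sup>2"
    using mult_right_mono[OF \<gamma>, of "(norm g1)\<^sup>2"] by simp
  moreover have "(norm (g2 - g1))\<^sup>2 \<le> 3 * (norm (f2 - f1))\<^sup>2 + 3 * (norm (g2 - f2))\<^sup>2 + 3 * (norm (f1 - g1))\<^sup>2"
    using tri[of "f2 - f1" "g2 - f2" "f1 - g1"] by simp
  ultimately have "(norm (g2 - g1))\<^sup>2 - (norm g1)\<^sup>2 \<le> 3 * ((norm (f2 - g2))\<^sup>2 + (norm (f1 - g1))\<^sup>2)"
    by (simp add: norm_minus_commute)
  then have "\<gamma>\<^sup>2 * ((norm (g2 - g1))\<^sup>2 - (norm g1)\<^sup>2) \<le> \<gamma>\<^sup>2 * (3 * ((norm (f2 - g2))\<^sup>2 + (norm (f1 - g1))\<^sup>2))"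
    by (intro mult_left_mono) auto
  moreover have "(norm (x - \<gamma> *\<^sub>R g2 - u))\<^sup>2 = (norm (x - u))\<^sup>2 - 2 * \<gamma> * (f2 \<bullet> (x' - u))
    + 2 * \<gamma> * ((f2 - g2) \<bullet> (x' - u)) + \<gamma>\<^sup>2 * ((norm (g2 - g1))\<^sup>2 - (norm g1)\<^sup>2)"
    unfolding x'_def power2_norm_eq_inner
    by (simp add: algebra_simps inner_commute power2_eq_square)
  ultimately show ?thesis by (simp only: mult.assoc mult.left_commute[of 3])
qed

section \<open>Minibatches\<close>

lemma integral_PiM_component:
  fixes f :: "'b \<Rightarrow> 'c::{banach, second_countable_topology}"
  assumes "prob_space D" and "i \<in> T" and f: "integrable D f"
  shows "integrable (Pi\<^sub>M T (\<lambda>_. D)) (\<lambda>z. f (z i))"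
    and "(\<integral>z. f (z i) \<partial>Pi\<^sub>M T (\<lambda>_. D)) = integral\<^sup>L D f"
proof -
  interpret D: prob_space D by fact
  interpret P: product_prob_space "\<lambda>_. D" T by unfold_locales
  have d: "distr (Pi\<^sub>M T (\<lambda>_. D)) D (\<lambda>z. z i) = D" using P.PiM_component \<open>i \<in> T\<close> .
  have m: "(\<lambda>z. z i) \<in> measurable (Pi\<^sub>M T (\<lambda>_. D)) D" using \<open>i \<in> T\<close> by measurable
  show "integrable (Pi\<^sub>M T (\<lambda>_. D)) (\<lambda>z. f (z i))"
    using integrable_distr[OF m, of f] f d by simp
  show "(\<integral>z. f (z i) \<partial>Pi\<^sub>M T (\<lambda>_. D)) = integral\<^sup>L D f"
    using integral_distr[OF m, of f] f d by simp
qed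

lemma integral_PiM_mult_distinct:
  fixes f g :: "'b \<Rightarrow> real"
  assumes "prob_space D" and "finite T" "i \<in> T" "j \<in> T" "i \<noteq> j"
    and f: "integrable D f" and g: "integrable D g"
  shows "integrable (Pi\<^sub>M T (\<lambda>_. D)) (\<lambda>z. f (z i) * g (z j))"
    and "(\<integral>z. f (z i) * g (z j) \<partial>Pi\<^sub>M T (\<lambda>_. D)) = integral\<^sup>L D f * integral\<^sup>L D g"
proof -
  interpret D: prob_space D by fact
  interpret P: product_prob_space "\<lambda>_. D" T by unfold_locales
  \<comment> \<open>Padding with the constant 1 makes the two-factor product a product over all of
    \<open>T\<close>, to which the product formula for finite product measures applies.\<close>
  define h where "h l = (if l = i then f else if l = j then g else (\<lambda>_. 1))" for l
  have h: "integrable D (h l)" for l using f g by (simp add: h_def)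
  have split: "(\<Prod>l\<in>T. a l) = a i * a j" if "\<And>l. l \<in> T \<Longrightarrow> l \<noteq> i \<Longrightarrow> l \<noteq> j \<Longrightarrow> a l = 1"
    for a :: "'a \<Rightarrow> real"
  proof -
    have "(\<Prod>l\<in>T. a l) = (\<Prod>l\<in>{i, j}. a l)"
      using assms that by (intro prod.mono_neutral_right) auto
    then show ?thesis using \<open>i \<noteq> j\<close> by simp
  qed
  have eq: "(\<Prod>l\<in>T. h l (z l)) = f (z i) * g (z j)" for z
    using \<open>i \<noteq> j\<close> by (subst split) (auto simp: h_def)
  show "integrable (Pi\<^sub>M T (\<lambda>_. D)) (\<lambda>z. f (z i) * g (z j))"
    using P.product_integrable_prod[of T h] h \<open>finite T\<close> by (simp add: eq)
  have "(\<Prod>l\<in>T. integral\<^sup>L D (h l)) = integral\<^sup>L D f * integral\<^sup>L D g"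
    using \<open>i \<noteq> j\<close> by (subst split) (auto simp: h_def D.prob_space)
  then show "(\<integral>z. f (z i) * g (z j) \<partial>Pi\<^sub>M T (\<lambda>_. D)) = integral\<^sup>L D f * integral\<^sup>L D g"
    using P.product_integral_prod[of T h] h \<open>finite T\<close> by (simp add: eq)
qed

text \<open>Expansion in an orthonormal basis reduces this to products of independent centred
  scalars. These are the cross terms of the minibatch variance.\<close>

lemma integral_PiM_inner_distinct:
  fixes h :: "'b \<Rightarrow> 'c::euclidean_space"
  assumes "prob_space D" and "finite T" "i \<in> T" "j \<in> T" "i \<noteq> j"
    and h: "integrable D h" and h0: "integral\<^sup>L D h = 0"
  shows "integrable (Pi\<^sub>M T (\<lambda>_. D)) (\<lambda>z. h (z i) \<bullet> h (z j))"
    and "(\<integral>z. h (z i) \<bullet> h (z j) \<partial>Pi\<^sub>M T (\<lambda>_. D)) = 0"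
proof -
  have hb: "integrable D (\<lambda>\<zeta>. h \<zeta> \<bullet> b)" for b using h by simp
  have hb0: "(\<integral>\<zeta>. h \<zeta> \<bullet> b \<partial>D) = 0" for b using h h0 by simp
  note m = integral_PiM_mult_distinct[OF assms(1-5) hb hb]
  have eq: "h (z i) \<bullet> h (z j) = (\<Sum>b\<in>Basis. (h (z i) \<bullet> b) * (h (z j) \<bullet> b))" for z
    by (rule euclidean_inner)
  show "integrable (Pi\<^sub>M T (\<lambda>_. D)) (\<lambda>z. h (z i) \<bullet> h (z j))"
    unfolding eq by (intro Bochner_Integration.integrable_sum m)
  have "(\<integral>z. h (z i) \<bullet> h (z j) \<partial>Pi\<^sub>M T (\<lambda>_. D))
      = (\<Sum>b\<in>Basis. \<integral>z. (h (z i) \<bullet> b) * (h (z j) \<bullet> b) \<partial>Pi\<^sub>M T (\<lambda>_. D))"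
    unfolding eq by (intro Bochner_Integration.integral_sum m)
  then show "(\<integral>z. h (z i) \<bullet> h (z j) \<partial>Pi\<^sub>M T (\<lambda>_. D)) = 0" by (simp add: m hb0)
qed

lemma minibatch_mean:
  fixes g :: "'b \<Rightarrow> 'c::euclidean_space"
  assumes "prob_space D" and T: "finite T" "T \<noteq> {}" and g: "integrable D g"
  shows "integrable (Pi\<^sub>M T (\<lambda>_. D)) (\<lambda>z. (1 / real (card T)) *\<^sub>R (\<Sum>i\<in>T. g (z i)))"
    and "(\<integral>z. (1 / real (card T)) *\<^sub>R (\<Sum>i\<in>T. g (z i)) \<partial>Pi\<^sub>M T (\<lambda>_. D)) = integral\<^sup>L D g"
proof -
  note c = integral_PiM_component[OF assms(1) _ g]
  show "integrable (Pi\<^sub>M T (\<lambda>_. D)) (\<lambda>z. (1 / real (card T)) *\<^sub>R (\<Sum>i\<in>T. g (z i)))"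
    by (intro integrable_scaleR_right Bochner_Integration.integrable_sum c)
  have "(\<integral>z. (\<Sum>i\<in>T. g (z i)) \<partial>Pi\<^sub>M T (\<lambda>_. D)) = (\<Sum>i\<in>T. integral\<^sup>L D g)"
    by (subst Bochner_Integration.integral_sum) (auto simp: c)
  then show "(\<integral>z. (1 / real (card T)) *\<^sub>R (\<Sum>i\<in>T. g (z i)) \<partial>Pi\<^sub>M T (\<lambda>_. D)) = integral\<^sup>L D g"
    using T by (simp add: sum_constant_scaleR)
qed

text \<open>The squared error expands into a double sum in which only the diagonal survives, so
  \<open>card T\<close> of the squared number of terms remain. The nonnegative integral in the
  hypothesis also supplies the square integrability.\<close>

lemma minibatch_variance:
  fixes g :: "'b \<Rightarrow> 'c::euclidean_space"
  assumes "prob_space D" and T: "finite T" "T \<noteq> {}" and g: "integrable D g" and v0: "0 \<le> v"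
    and v: "(\<integral>\<^sup>+\<zeta>. ennreal ((norm (g \<zeta> - integral\<^sup>L D g))\<^sup>2) \<partial>D) \<le> ennreal v"
  defines "err \<equiv> \<lambda>z. (norm ((1 / real (card T)) *\<^sub>R (\<Sum>i\<in>T. g (z i)) - integral\<^sup>L D g))\<^sup>2"
  shows "integrable (Pi\<^sub>M T (\<lambda>_. D)) err"
    and "(\<integral>z. err z \<partial>Pi\<^sub>M T (\<lambda>_. D)) \<le> v / real (card T)"
proof -
  interpret D: prob_space D by fact
  define h where "h \<zeta> = g \<zeta> - integral\<^sup>L D g" for \<zeta>
  define n where "n = real (card T)"
  have n: "n > 0" using T by (simp add: n_def card_gt_0_iff)
  have h: "integrable D h" unfolding h_def using g by simp
  have h0: "integral\<^sup>L D h = 0" unfolding h_def using g by (simp add: D.prob_space)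
  have h_meas: "h \<in> borel_measurable D" using h by simp
  have i2: "integrable D (\<lambda>\<zeta>. h \<zeta> \<bullet> h \<zeta>)"
  proof (rule integrableI_bounded)
    show "(\<integral>\<^sup>+\<zeta>. ennreal (norm (h \<zeta> \<bullet> h \<zeta>)) \<partial>D) < \<infinity>"
      using v by (simp add: h_def power2_norm_eq_inner le_less_trans ennreal_less_top)
  qed (use h_meas in measurable)
  have "ennreal (\<integral>\<zeta>. h \<zeta> \<bullet> h \<zeta> \<partial>D) \<le> ennreal v"
    using v by (subst nn_integral_eq_integral[symmetric, OF i2]) (auto simp: h_def power2_norm_eq_inner)
  then have v2: "(\<integral>\<zeta>. h \<zeta> \<bullet> h \<zeta> \<partial>D) \<le> v" using v0 by simp
  have err: "err z = (1 / n\<^sup>2) * (\<Sum>i\<in>T. \<Sum>j\<in>T. h (z i) \<bullet> h (z j))" for z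
  proof -
    have "(1 / n) *\<^sub>R (\<Sum>i\<in>T. g (z i)) - integral\<^sup>L D g = (1 / n) *\<^sub>R (\<Sum>i\<in>T. h (z i))"
      using n by (simp add: h_def sum_subtractf sum_constant_scaleR n_def scaleR_diff_right)
    then have "err z = (1 / n\<^sup>2) * ((\<Sum>i\<in>T. h (z i)) \<bullet> (\<Sum>j\<in>T. h (z j)))"
      unfolding err_def n_def[symmetric] power2_norm_eq_inner by (simp add: power2_eq_square)
    then show ?thesis by (simp only: inner_sum_left) (simp only: inner_sum_right)
  qed
  have int: "integrable (Pi\<^sub>M T (\<lambda>_. D)) (\<lambda>z. h (z i) \<bullet> h (z j))" if "i \<in> T" "j \<in> T" for i j
    using integral_PiM_inner_distinct(1)[OF assms(1) T(1) that _ h h0]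
      integral_PiM_component(1)[OF assms(1) that(1) i2] by (cases "i = j") auto
  show "integrable (Pi\<^sub>M T (\<lambda>_. D)) err"
    unfolding err[abs_def]
    by (intro integrable_mult_right Bochner_Integration.integrable_sum int)
  have "(\<integral>z. h (z i) \<bullet> h (z j) \<partial>Pi\<^sub>M T (\<lambda>_. D)) = (if i = j then \<integral>\<zeta>. h \<zeta> \<bullet> h \<zeta> \<partial>D else 0)"
    if "i \<in> T" "j \<in> T" for i j
    using integral_PiM_inner_distinct(2)[OF assms(1) T(1) that _ h h0]
      integral_PiM_component(2)[OF assms(1) that(1) i2] by auto
  then have "(\<Sum>i\<in>T. \<Sum>j\<in>T. \<integral>z. h (z i) \<bullet> h (z j) \<partial>Pi\<^sub>M T (\<lambda>_. D)) = n * (\<integral>\<zeta>. h \<zeta> \<bullet> h \<zeta> \<partial>D)"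
    using T by (simp add: n_def)
  moreover have "(\<integral>z. (\<Sum>i\<in>T. \<Sum>j\<in>T. h (z i) \<bullet> h (z j)) \<partial>Pi\<^sub>M T (\<lambda>_. D))
      = (\<Sum>i\<in>T. \<Sum>j\<in>T. \<integral>z. h (z i) \<bullet> h (z j) \<partial>Pi\<^sub>M T (\<lambda>_. D))"
  proof -
    have "(\<integral>z. (\<Sum>i\<in>T. \<Sum>j\<in>T. h (z i) \<bullet> h (z j)) \<partial>Pi\<^sub>M T (\<lambda>_. D))
        = (\<Sum>i\<in>T. \<integral>z. (\<Sum>j\<in>T. h (z i) \<bullet> h (z j)) \<partial>Pi\<^sub>M T (\<lambda>_. D))"
      by (intro Bochner_Integration.integral_sum Bochner_Integration.integrable_sum int)
    also have "\<dots> = (\<Sum>i\<in>T. \<Sum>j\<in>T. \<integral>z. h (z i) \<bullet> h (z j) \<partial>Pi\<^sub>M T (\<lambda>_. D))"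
      by (intro sum.cong refl Bochner_Integration.integral_sum int)
    finally show ?thesis .
  qed
  ultimately have "(\<integral>z. err z \<partial>Pi\<^sub>M T (\<lambda>_. D)) = (1 / n\<^sup>2) * (n * (\<integral>\<zeta>. h \<zeta> \<bullet> h \<zeta> \<partial>D))"
    unfolding err by simp
  also have "\<dots> \<le> v / n" using v2 n by (simp add: power2_eq_square field_simps)
  finally show "(\<integral>z. err z \<partial>Pi\<^sub>M T (\<lambda>_. D)) \<le> v / real (card T)" by (simp add: n_def)
qed

lemma borel_measurable_clip [measurable]:
  "(\<lambda>y::'a::euclidean_space. clip y lam) \<in> borel_measurable borel"
  unfolding clip_def by measurable

text \<open>Adaptedness of the iterates: the minibatches of iteration \<open>k\<close> are still
  fresh when \<open>x\<^sup>k\<close> is known.\<close>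

lemma clipped_SEG_cong:
  assumes "\<And>s l i. s \<in> {1, 2} \<Longrightarrow> l < k \<Longrightarrow> i \<in> {1..m} \<Longrightarrow> \<xi> s l i = \<xi>' s l i"
  shows "clipped_SEG G x0 \<gamma>1 \<gamma>2 lam1 lam2 (\<lambda>_. m) (\<lambda>_. m) \<xi> k
    = clipped_SEG G x0 \<gamma>1 \<gamma>2 lam1 lam2 (\<lambda>_. m) (\<lambda>_. m) \<xi>' k"
  using assms
proof (induction k)
  case (Suc k)
  then have "clipped_SEG G x0 \<gamma>1 \<gamma>2 lam1 lam2 (\<lambda>_. m) (\<lambda>_. m) \<xi> k
    = clipped_SEG G x0 \<gamma>1 \<gamma>2 lam1 lam2 (\<lambda>_. m) (\<lambda>_. m) \<xi>' k" by simp
  moreover have "clipped_estimate G m l (\<xi> s k) x = clipped_estimate G m l (\<xi>' s k) x"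
    if "s \<in> {1, 2}" for s l x
    using Suc.prems[OF that] by (simp add: clipped_estimate_def)
  ultimately show ?case by (simp add: Let_def)
qed simp

section \<open>The stopped potential\<close>

text \<open>\<open>A\<close> stands for the logarithm; \<open>\<beta>\<close> returns only when
  \<open>exp (- 2 * A)\<close> is compared with it. The product form of the step size condition
  covers \<open>L = 0\<close>.\<close>

locale clipped_SEG_analysis = D: prob_space D
  for D :: "'b measure" +
  fixes F :: "'a::euclidean_space \<Rightarrow> 'a" and G :: "'b \<Rightarrow> 'a \<Rightarrow> 'a"
    and x0 xs :: 'a and R \<sigma> L \<gamma> lam A :: real and m K :: nat
  assumes oracle_measurable: "(\<lambda>(\<zeta>, x). G \<zeta> x) \<in> borel_measurable (D \<Otimes>\<^sub>M borel)"
    and unbiased: "\<And>x. has_bochner_integral D (\<lambda>\<zeta>. G \<zeta> x) (F x)"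
    and F_xs: "F xs = 0" and R_pos: "R > 0" and x0_near: "norm (x0 - xs) \<le> R"
    and bounded_variance: "\<And>x. x \<in> cball xs (4 * R) \<Longrightarrow>
          (\<integral>\<^sup>+ \<zeta>. ennreal ((norm (G \<zeta> x - F x))\<^sup>2) \<partial>D) \<le> ennreal (\<sigma>\<^sup>2)"
    and lipschitz: "L-lipschitz_on (cball xs (4 * R)) F"
    and monotone: "\<And>x y. x \<in> cball xs (4 * R) \<Longrightarrow> y \<in> cball xs (4 * R) \<Longrightarrow>
          (F x - F y) \<bullet> (x - y) \<ge> 0"
    and A_ge_1: "A \<ge> 1" and \<gamma>_pos: "\<gamma> > 0"
    and stepsize: "160 * (L * \<gamma> * A) \<le> 1"
    and clipping_level: "lam = R / (20 * \<gamma> * A)"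
    and m_pos: "m > 0"
    and batchsize: "10800 * (real K + 1) * \<gamma>\<^sup>2 * \<sigma>\<^sup>2 * A / R\<^sup>2 \<le> real m"
begin

lemma lam_pos: "lam > 0" using clipping_level R_pos \<gamma>_pos A_ge_1 by simp

lemma \<gamma>_lam_le: "\<gamma> * lam \<le> R / 20"
  using R_pos \<gamma>_pos A_ge_1 by (simp add: clipping_level field_simps)

lemma L_nonneg: "0 \<le> L" using lipschitz by (rule lipschitz_on_nonneg)

lemma L\<gamma>_le: "L * \<gamma> \<le> 1 / 160"
  using mult_left_mono[OF A_ge_1, of "L * \<gamma>"] L_nonneg \<gamma>_pos stepsize by simp

text \<open>Near the zero \<open>xs\<close> the exact operator stays at half the clipping level, as
  both clipping estimates require: \<open>3 / 160 \<le> 1 / 40\<close> after Lipschitz continuity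
  and the step size condition.\<close>

lemma F_bounded: "norm (F x) \<le> lam / 2" if "norm (x - xs) \<le> 3 * R"
proof -
  have "norm (F x) \<le> L * norm (x - xs)"
    using lipschitz_onD[OF lipschitz, of x xs] that R_pos F_xs
    by (simp add: dist_norm norm_minus_commute)
  also have "\<dots> \<le> L * (3 * R)" using that L_nonneg by (intro mult_left_mono) auto
  also have "\<dots> = (L * \<gamma> * A) * (3 * R / (\<gamma> * A))" using \<gamma>_pos A_ge_1 by (simp add: field_simps)
  also have "\<dots> \<le> 1 / 160 * (3 * R / (\<gamma> * A))"
    using stepsize \<gamma>_pos A_ge_1 R_pos by (intro mult_right_mono) auto
  also have "\<dots> \<le> lam / 2"
    using R_pos \<gamma>_pos A_ge_1 by (simp add: clipping_level field_simps)
  finally show ?thesis .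
qed

text \<open>All samples form one function on index triples, so that their joint law is a single
  product measure and the iterates are deterministic maps on it.\<close>

definition xk :: "nat \<Rightarrow> (nat \<times> nat \<times> nat \<Rightarrow> 'b) \<Rightarrow> 'a" where
  "xk k y = clipped_SEG G x0 \<gamma> \<gamma> (\<lambda>_. lam) (\<lambda>_. lam) (\<lambda>_. m) (\<lambda>_. m) (\<lambda>s k i. y (s, k, i)) k"

definition xt :: "nat \<Rightarrow> (nat \<times> nat \<times> nat \<Rightarrow> 'b) \<Rightarrow> 'a" where
  "xt k y = clipped_SEG_tilde G x0 \<gamma> \<gamma> (\<lambda>_. lam) (\<lambda>_. lam) (\<lambda>_. m) (\<lambda>_. m) (\<lambda>s k i. y (s, k, i)) k"

definition batch :: "nat \<Rightarrow> nat \<Rightarrow> (nat \<times> nat \<times> nat) set" where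
  "batch s k = {s} \<times> {k} \<times> {1..m}"

definition mb :: "nat \<Rightarrow> nat \<Rightarrow> (nat \<times> nat \<times> nat \<Rightarrow> 'b) \<Rightarrow> 'a \<Rightarrow> 'a" where
  "mb s k y x = (1 / real (card (batch s k))) *\<^sub>R (\<Sum>j\<in>batch s k. G (y j) x)"

lemma finite_batch [simp]: "finite (batch s k)" by (simp add: batch_def)
lemma card_batch: "card (batch s k) = m" by (simp add: batch_def card_cartesian_product)
lemma batch_nonempty: "batch s k \<noteq> {}" using m_pos by (auto simp: batch_def)

lemma clipped_estimate_eq: "clipped_estimate G m lam (\<lambda>i. y (s, k, i)) x = clip (mb s k y x) lam"
proof -
  have "batch s k = (\<lambda>i. (s, k, i)) ` {1..m}" by (auto simp: batch_def)
  then have "(\<Sum>j\<in>batch s k. G (y j) x) = (\<Sum>i=1..m. G (y (s, k, i)) x)"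
    by (simp add: sum.reindex inj_on_def)
  then show ?thesis unfolding clipped_estimate_def mb_def card_batch by simp
qed

lemma xk_0 [simp]: "xk 0 y = x0" by (simp add: xk_def)

lemma xt_eq: "xt k y = xk k y - \<gamma> *\<^sub>R clip (mb 1 k y (xk k y)) lam"
  by (simp add: xt_def xk_def clipped_SEG_tilde_def Let_def flip: clipped_estimate_eq)

lemma xk_Suc: "xk (Suc k) y = xk k y - \<gamma> *\<^sub>R clip (mb 2 k y (xt k y)) lam"
  by (simp add: xt_def xk_def clipped_SEG_tilde_def Let_def flip: clipped_estimate_eq)

definition err1 where "err1 k y = F (xk k y) - clip (mb 1 k y (xk k y)) lam"
definition err2 where "err2 k y = F (xt k y) - clip (mb 2 k y (xt k y)) lam"
definition drift where "drift k y = \<gamma> *\<^sub>R (\<Sum>l<k. err2 l y)"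

text \<open>The extragradient step contributes 3 to both squares. The growth of
  \<open>(norm (drift k y))\<^sup>2\<close> adds one more square of \<open>err2\<close> and the
  inner product with \<open>drift\<close>.\<close>

definition increment where
  "increment k y = 2 * \<gamma> * (err2 k y \<bullet> (xt k y - xs + drift k y))
     + \<gamma>\<^sup>2 * (4 * (norm (err2 k y))\<^sup>2 + 3 * (norm (err1 k y))\<^sup>2)"

text \<open>Freezing keeps a process that has left the good region above \<open>4 R\<^sup>2\<close>, so that a bound on
  the final value alone implies that all earlier values are good.\<close>

primrec pot :: "nat \<Rightarrow> (nat \<times> nat \<times> nat \<Rightarrow> 'b) \<Rightarrow> real" where
  "pot 0 y = R\<^sup>2"
| "pot (Suc k) y = (if pot k y \<le> 4 * R\<^sup>2 then pot k y + increment k y else pot k y)"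

lemma pot_good_mono: "pot k y \<le> 4 * R\<^sup>2" if "pot (k + n) y \<le> 4 * R\<^sup>2"
  using that by (induction n) (auto split: if_splits)

lemma xt_near: "norm (xt k y - xk k y) \<le> R / 20"
proof -
  have "norm (xt k y - xk k y) = \<gamma> * norm (clip (mb 1 k y (xk k y)) lam)"
    using \<gamma>_pos by (simp add: xt_eq)
  also have "\<dots> \<le> \<gamma> * lam" using norm_clip_le[OF lam_pos] \<gamma>_pos by (intro mult_left_mono) auto
  finally show ?thesis using \<gamma>_lam_le by simp
qed

lemma xt_near_xs: "norm (xt k y - xs) \<le> 3 * R" if "norm (xk k y - xs) \<le> 2 * R"
  using norm_triangle_ineq[of "xt k y - xk k y" "xk k y - xs"] xt_near[of k y] that R_pos by simp

lemma step_le: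
  assumes x: "norm (xk k y - xs) \<le> 2 * R"
  shows "(norm (xk (Suc k) y - u))\<^sup>2 \<le> (norm (xk k y - u))\<^sup>2 - 2 * \<gamma> * (F (xt k y) \<bullet> (xt k y - u))
    + 2 * \<gamma> * (err2 k y \<bullet> (xt k y - u)) + 3 * \<gamma>\<^sup>2 * ((norm (err2 k y))\<^sup>2 + (norm (err1 k y))\<^sup>2)"
  unfolding xk_Suc err1_def err2_def xt_eq
proof (rule extragradient_step, fold xt_eq)
  have "norm (xt k y - xs) \<le> 3 * R" using xt_near_xs[OF x] .
  then show "norm (F (xt k y) - F (xk k y)) \<le> L * norm (xt k y - xk k y)"
    using lipschitz_onD[OF lipschitz, of "xt k y" "xk k y"] x R_pos
    by (simp add: dist_norm norm_minus_commute)
  have "(L * \<gamma>)\<^sup>2 \<le> (1 / 160)\<^sup>2" using L\<gamma>_le L_nonneg \<gamma>_pos by (intro power_mono) auto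
  then show "3 * (L * \<gamma>)\<^sup>2 \<le> 1" by (simp add: power2_eq_square)
qed

lemma drift_Suc: "drift (Suc k) y = drift k y + \<gamma> *\<^sub>R err2 k y"
  by (simp add: drift_def algebra_simps)

lemma norm_drift_Suc: "(norm (drift (Suc k) y))\<^sup>2
   = (norm (drift k y))\<^sup>2 + 2 * \<gamma> * (err2 k y \<bullet> drift k y) + \<gamma>\<^sup>2 * (norm (err2 k y))\<^sup>2"
  unfolding drift_Suc power2_norm_eq_inner
  by (simp add: algebra_simps inner_commute power2_eq_square)

lemma near_of_sq_le: "norm v \<le> 2 * R" if "(norm v)\<^sup>2 + (norm w)\<^sup>2 \<le> 4 * R\<^sup>2" for v w :: 'a
proof -
  have "(norm v)\<^sup>2 \<le> (norm v)\<^sup>2 + (norm w)\<^sup>2" by simp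
  also have "\<dots> \<le> (2 * R)\<^sup>2" using that by (simp add: power_mult_distrib)
  finally have "(norm v)\<^sup>2 \<le> (2 * R)\<^sup>2" .
  then show ?thesis by (rule power2_le_imp_le) (use R_pos in simp)
qed

text \<open>Locality and descent feed each other in one induction: a value of at most
  \<open>4 * R\<^sup>2\<close> puts \<open>xk k y\<close> within \<open>2 * R\<close> of
  \<open>xs\<close>, hence \<open>xt k y\<close> into the ball of the assumptions, and there
  monotonicity against the zero \<open>xs\<close> gives the operator term a sign that allows
  dropping it.\<close>

lemma pot_bounds:
  assumes "pot k y \<le> 4 * R\<^sup>2"
  shows "(norm (xk k y - xs))\<^sup>2 + (norm (drift k y))\<^sup>2 \<le> pot k y"
  using assms
proof (induction k)
  case 0
  have "(norm (x0 - xs))\<^sup>2 \<le> R\<^sup>2" using x0_near by (intro power_mono) auto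
  then show ?case by (simp add: drift_def)
next
  case (Suc k)
  have g: "pot k y \<le> 4 * R\<^sup>2" using Suc.prems by (auto split: if_splits)
  note IH = Suc.IH[OF g]
  have x: "norm (xk k y - xs) \<le> 2 * R" using near_of_sq_le[OF order_trans[OF IH g]] .
  have "(F (xt k y) - F xs) \<bullet> (xt k y - xs) \<ge> 0"
    using xt_near_xs[OF x] R_pos by (intro monotone) (auto simp: dist_norm norm_minus_commute)
  then have "2 * \<gamma> * (F (xt k y) \<bullet> (xt k y - xs)) \<ge> 0" using \<gamma>_pos F_xs by simp
  then have "(norm (xk (Suc k) y - xs))\<^sup>2 + (norm (drift (Suc k) y))\<^sup>2
     \<le> (norm (xk k y - xs))\<^sup>2 + (norm (drift k y))\<^sup>2 + increment k y"
    using step_le[OF x, of xs]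
    unfolding norm_drift_Suc increment_def by (simp add: algebra_simps)
  then show ?case using IH g by simp
qed

text \<open>The radius \<open>5 * R = 3 * R + 2 * R\<close> is the bound on \<open>w\<close> in
  \<open>exp_noise_le\<close>.\<close>

lemma good_near:
  assumes "pot k y \<le> 4 * R\<^sup>2"
  shows "norm (xk k y - xs) \<le> 2 * R" "norm (xt k y - xs) \<le> 3 * R"
    "norm (xt k y - xs + drift k y) \<le> 5 * R"
proof -
  have b: "(norm (xk k y - xs))\<^sup>2 + (norm (drift k y))\<^sup>2 \<le> 4 * R\<^sup>2"
    using pot_bounds[OF assms] assms by linarith
  show "norm (xk k y - xs) \<le> 2 * R" using near_of_sq_le[OF b] .
  then show t: "norm (xt k y - xs) \<le> 3 * R" by (rule xt_near_xs)
  have "norm (drift k y) \<le> 2 * R" using near_of_sq_le[of "drift k y" "xk k y - xs"] b by simp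
  then show "norm (xt k y - xs + drift k y) \<le> 5 * R"
    using t norm_triangle_ineq[of "xt k y - xs" "drift k y"] by linarith
qed

section \<open>The gap on the good event\<close>

text \<open>Telescoping the step inequality for a general \<open>u\<close> leaves errors paired with
  \<open>u\<close>; they collect into the single linear term in \<open>drift\<close>, so the noise
  is controlled uniformly in \<open>u\<close>.\<close>

lemma sum_gap_le:
  assumes "pot k y \<le> 4 * R\<^sup>2"
  shows "2 * \<gamma> * (\<Sum>l<k. F (xt l y) \<bullet> (xt l y - u)) \<le> (norm (x0 - u))\<^sup>2 - (norm (xk k y - u))\<^sup>2
    + pot k y - R\<^sup>2 - (norm (drift k y))\<^sup>2 + 2 * (drift k y \<bullet> (xs - u))"
  using assms
proof (induction k)
  case 0
  then show ?case by (simp add: drift_def)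
next
  case (Suc k)
  have g: "pot k y \<le> 4 * R\<^sup>2" using Suc.prems by (auto simp: split: if_splits)
  have "2 * \<gamma> * (F (xt k y) \<bullet> (xt k y - u)) \<le> (norm (xk k y - u))\<^sup>2 - (norm (xk (Suc k) y - u))\<^sup>2
    + 2 * \<gamma> * (err2 k y \<bullet> (xt k y - u)) + 3 * \<gamma>\<^sup>2 * ((norm (err2 k y))\<^sup>2 + (norm (err1 k y))\<^sup>2)"
    using step_le[OF good_near(1)[OF g], of u] by linarith
  \<comment> \<open>Here \<open>xt k y - u\<close> is split into
    \<open>xt k y - xs + drift k y\<close>, \<open>- drift k y\<close> and \<open>xs - u\<close>:
    the first part belongs to \<open>increment\<close>, the second to the growth of the squared
    drift, the third telescopes.\<close>
  also have "\<dots> = (norm (xk k y - u))\<^sup>2 - (norm (xk (Suc k) y - u))\<^sup>2 + increment k y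
     - ((norm (drift (Suc k) y))\<^sup>2 - (norm (drift k y))\<^sup>2) + 2 * ((drift (Suc k) y - drift k y) \<bullet> (xs - u))"
    unfolding norm_drift_Suc increment_def by (simp add: drift_Suc algebra_simps)
  finally show ?case using Suc.IH[OF g] g by (simp add: algebra_simps)
qed

lemma gap_le_of_good:
  assumes g: "pot (Suc K) y \<le> 4 * R\<^sup>2"
  shows "Gap F xs R ((1 / (real K + 1)) *\<^sub>R (\<Sum>k=0..K. xt k y)) \<le> 9 * R\<^sup>2 / (2 * \<gamma> * (real K + 1))"
  unfolding Gap_def
proof (rule cSUP_least)
  show "cball xs R \<noteq> {}" using R_pos by simp
  fix u assume u: "u \<in> cball xs R"
  then have u': "norm (xs - u) \<le> R" by (simp add: dist_norm)
  define d where "d = drift (Suc K) y"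
  \<comment> \<open>Freezing makes all earlier values good, so monotonicity applies on the ball and
    moves the operator from \<open>xt l y\<close> to \<open>u\<close>.\<close>
  have mon: "F u \<bullet> (xt l y - u) \<le> F (xt l y) \<bullet> (xt l y - u)" if "l < Suc K" for l
  proof -
    have "pot l y \<le> 4 * R\<^sup>2" using pot_good_mono[of l "Suc K - l" y] g that by simp
    then have "xt l y \<in> cball xs (4 * R)"
      using good_near(2)[of l y] R_pos by (simp add: dist_norm norm_minus_commute)
    then have "(F (xt l y) - F u) \<bullet> (xt l y - u) \<ge> 0" using u R_pos by (intro monotone) auto
    then show ?thesis by (simp add: algebra_simps)
  qed
  have "norm (x0 - u) \<le> 2 * R"
    using norm_triangle_ineq[of "x0 - xs" "xs - u"] x0_near u' by simp
  then have "(norm (x0 - u))\<^sup>2 \<le> (2 * R)\<^sup>2" by (intro power_mono) auto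
  then have "(norm (x0 - u))\<^sup>2 \<le> 4 * R\<^sup>2" by (simp add: power_mult_distrib)
  \<comment> \<open>The weights are chosen so that \<open>(norm d)\<^sup>2\<close> cancels against
    the negative term of \<open>sum_gap_le\<close>.\<close>
  moreover have "2 * (d \<bullet> (xs - u)) \<le> (norm d)\<^sup>2 + R\<^sup>2"
  proof -
    have "d \<bullet> (xs - u) \<le> norm d * norm (xs - u)" by (rule norm_cauchy_schwarz)
    also have "\<dots> \<le> norm d * R" using u' by (intro mult_left_mono) auto
    finally show ?thesis using zero_le_power2[of "norm d - R"]
      by (simp add: power2_eq_square algebra_simps)
  qed
  ultimately have b: "2 * \<gamma> * (\<Sum>l<Suc K. F (xt l y) \<bullet> (xt l y - u)) \<le> 9 * R\<^sup>2"
    using sum_gap_le[OF g, of u] g zero_le_power2[of "norm (xk (Suc K) y - u)"]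
      zero_le_power2[of R]
    unfolding d_def[symmetric] by linarith
  \<comment> \<open>The gap functional is affine in the averaged point, so the bounds for the
    individual points can be added.\<close>
  define v where "v = (1 / (real K + 1)) *\<^sub>R (\<Sum>k=0..K. xt k y) - u"
  have "(real K + 1) *\<^sub>R v = (\<Sum>l<Suc K. xt l y - u)"
    unfolding v_def sum_subtractf sum_constant_scaleR
    by (simp add: algebra_simps atLeast0AtMost lessThan_Suc_atMost)
  then have "(real K + 1) * (F u \<bullet> v) = (\<Sum>l<Suc K. F u \<bullet> (xt l y - u))"
    unfolding inner_sum_right[symmetric] by (simp flip: inner_scaleR_right)
  also have "\<dots> \<le> (\<Sum>l<Suc K. F (xt l y) \<bullet> (xt l y - u))" using mon by (intro sum_mono) auto
  finally have "2 * \<gamma> * ((real K + 1) * (F u \<bullet> v)) \<le> 2 * \<gamma> * (\<Sum>l<Suc K. F (xt l y) \<bullet> (xt l y - u))"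
    using \<gamma>_pos by (intro mult_left_mono) auto
  also note b
  also have "2 * \<gamma> * ((real K + 1) * (F u \<bullet> v)) = (F u \<bullet> v) * (2 * \<gamma> * (real K + 1))" by simp
  finally have "(F u \<bullet> v) * (2 * \<gamma> * (real K + 1)) \<le> 9 * R\<^sup>2" .
  then show "F u \<bullet> ((1 / (real K + 1)) *\<^sub>R (\<Sum>k=0..K. xt k y) - u) \<le> 9 * R\<^sup>2 / (2 * \<gamma> * (real K + 1))"
    unfolding v_def[symmetric] using \<gamma>_pos by (simp add: pos_le_divide_eq)
qed

section \<open>Exponential moments of the potential\<close>

declare pot.simps(2) [simp del] One_nat_def [simp del]

section \<open>Dependence on the samples and measurability\<close>

definition idx :: "nat \<Rightarrow> (nat \<times> nat \<times> nat) set" where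
  "idx k = {1, 2} \<times> {0..<k} \<times> {1..m}"

abbreviation samples where "samples J \<equiv> Pi\<^sub>M J (\<lambda>_. D)"

lemma idx_Suc: "idx (Suc k) = (idx k \<union> batch 1 k) \<union> batch 2 k"
  by (auto simp: idx_def batch_def)

lemma idx_mono: "l \<le> k \<Longrightarrow> idx l \<subseteq> idx k" by (auto simp: idx_def)

lemma batch_subset_idx: "s \<in> {1, 2} \<Longrightarrow> l < k \<Longrightarrow> batch s l \<subseteq> idx k"
  by (auto simp: idx_def batch_def)

lemma idx_disjoint: "idx k \<inter> batch s k = {}" "(idx k \<union> batch 1 k) \<inter> batch 2 k = {}"
  by (auto simp: idx_def batch_def)

lemma finite_idx [simp]: "finite (idx k)" by (simp add: idx_def)

lemma mb_cong: "(\<And>j. j \<in> batch s k \<Longrightarrow> y j = y' j) \<Longrightarrow> mb s k y x = mb s k y' x"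
  by (simp add: mb_def)

text \<open>This and the following congruence rules record which samples a quantity depends on.
  Under the product measure, integrating over the remaining coordinates then acts as a conditional
  expectation.\<close>

lemma xk_cong: "(\<And>j. j \<in> idx k \<Longrightarrow> y j = y' j) \<Longrightarrow> xk k y = xk k y'"
  unfolding xk_def by (rule clipped_SEG_cong) (simp add: idx_def)

lemma xt_cong: "xt k y = xt k y'" if "\<And>j. j \<in> idx k \<union> batch 1 k \<Longrightarrow> y j = y' j"
proof -
  have "xk k y = xk k y'" by (rule xk_cong) (use that in blast)
  moreover have "mb 1 k y x = mb 1 k y' x" for x by (rule mb_cong) (use that in blast)
  ultimately show ?thesis by (simp add: xt_eq)
qed

lemma err_cong:
  assumes "\<And>j. j \<in> idx (Suc k) \<Longrightarrow> y j = y' j"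
  shows "err1 k y = err1 k y'" "err2 k y = err2 k y'"
proof -
  have "xk k y = xk k y'" by (rule xk_cong) (use assms idx_Suc in blast)
  moreover have "xt k y = xt k y'" by (rule xt_cong) (use assms idx_Suc in blast)
  moreover have "mb 1 k y x = mb 1 k y' x" for x by (rule mb_cong) (use assms idx_Suc in blast)
  moreover have "mb 2 k y x = mb 2 k y' x" for x by (rule mb_cong) (use assms idx_Suc in blast)
  ultimately show "err1 k y = err1 k y'" "err2 k y = err2 k y'" by (simp_all add: err1_def err2_def)
qed

lemma drift_cong: "(\<And>j. j \<in> idx k \<Longrightarrow> y j = y' j) \<Longrightarrow> drift k y = drift k y'"
proof (induction k)
  case (Suc k)
  have "drift k y = drift k y'" using Suc idx_Suc by blast
  moreover have "err2 k y = err2 k y'" using Suc.prems by (rule err_cong)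
  ultimately show ?case by (simp add: drift_Suc)
qed (simp add: drift_def)

lemma pot_cong: "(\<And>j. j \<in> idx k \<Longrightarrow> y j = y' j) \<Longrightarrow> pot k y = pot k y'"
proof (induction k)
  case (Suc k)
  have "pot k y = pot k y'" using Suc idx_Suc by blast
  moreover have "drift k y = drift k y'" by (rule drift_cong) (use Suc.prems idx_Suc in blast)
  moreover have "xt k y = xt k y'" by (rule xt_cong) (use Suc.prems idx_Suc in blast)
  moreover have "err1 k y = err1 k y'" using Suc.prems by (rule err_cong)
  moreover have "err2 k y = err2 k y'" using Suc.prems by (rule err_cong)
  ultimately show ?case by (simp add: pot.simps(2) increment_def)
qed simp

text \<open>Lipschitz continuity holds only on a ball; global measurability comes from writing
  \<open>F\<close> as a parameter integral of the jointly measurable oracle.\<close>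

lemma F_measurable [measurable]: "F \<in> borel_measurable borel"
proof -
  have "(\<lambda>(x, \<zeta>). G \<zeta> x) \<in> borel_measurable (borel \<Otimes>\<^sub>M D)"
    using measurable_pair_swap[OF oracle_measurable] by (simp add: case_prod_beta)
  then have "(\<lambda>x. \<integral>\<zeta>. G \<zeta> x \<partial>D) \<in> borel_measurable borel"
    by (rule D.borel_measurable_lebesgue_integral)
  moreover have "(\<lambda>x. \<integral>\<zeta>. G \<zeta> x \<partial>D) = F"
    using has_bochner_integral_integral_eq[OF unbiased] by blast
  ultimately show ?thesis by simp
qed

text \<open>The evaluation point is itself random, hence the use of joint measurability of the
  oracle.\<close>

lemma mb_measurable:
  assumes "batch s k \<subseteq> J" and X: "X \<in> borel_measurable (samples J)"
  shows "(\<lambda>y. mb s k y (X y)) \<in> borel_measurable (samples J)"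
proof -
  have "(\<lambda>y. G (y j) (X y)) \<in> borel_measurable (samples J)" if "j \<in> batch s k" for j
  proof -
    have "(\<lambda>y. y j) \<in> measurable (samples J) D" using assms(1) that by (intro measurable_component_singleton) auto
    then have "(\<lambda>y. (y j, X y)) \<in> measurable (samples J) (D \<Otimes>\<^sub>M borel)" using X by measurable
    from measurable_compose[OF this oracle_measurable] show ?thesis by simp
  qed
  then show ?thesis unfolding mb_def by (intro borel_measurable_scaleR borel_measurable_sum) auto
qed

lemma clip_mb_measurable:
  assumes "batch s k \<subseteq> J" and X: "X \<in> borel_measurable (samples J)"
  shows "(\<lambda>y. clip (mb s k y (X y)) lam) \<in> borel_measurable (samples J)"
  using measurable_compose[OF mb_measurable[OF assms] borel_measurable_clip] .

lemma xt_measurable_of_xk: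
  assumes "xk k \<in> borel_measurable (samples J)" "batch 1 k \<subseteq> J"
  shows "xt k \<in> borel_measurable (samples J)"
  unfolding xt_eq[abs_def]
  using assms by (intro borel_measurable_diff borel_measurable_scaleR clip_mb_measurable) auto

lemma xk_measurable: "idx k \<subseteq> J \<Longrightarrow> xk k \<in> borel_measurable (samples J)"
proof (induction k)
  case (Suc k)
  then have "xk k \<in> borel_measurable (samples J)" by (auto simp: idx_Suc)
  moreover from this have "xt k \<in> borel_measurable (samples J)"
    by (rule xt_measurable_of_xk) (use Suc.prems in \<open>auto simp: idx_Suc\<close>)
  ultimately show ?case
    unfolding xk_Suc[abs_def] using Suc.prems
    by (intro borel_measurable_diff borel_measurable_scaleR clip_mb_measurable) (auto simp: idx_Suc)
qed (simp add: xk_0[abs_def])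

lemma xt_measurable: "idx k \<union> batch 1 k \<subseteq> J \<Longrightarrow> xt k \<in> borel_measurable (samples J)"
  by (rule xt_measurable_of_xk[OF xk_measurable]) auto

lemma err_measurable:
  assumes "idx (Suc k) \<subseteq> J"
  shows "err1 k \<in> borel_measurable (samples J)" "err2 k \<in> borel_measurable (samples J)"
proof -
  have x: "xk k \<in> borel_measurable (samples J)" "xt k \<in> borel_measurable (samples J)"
    using assms unfolding idx_Suc by (auto intro!: xk_measurable xt_measurable)
  show "err1 k \<in> borel_measurable (samples J)" "err2 k \<in> borel_measurable (samples J)"
    unfolding err1_def[abs_def] err2_def[abs_def]
    using assms x unfolding idx_Suc
    by (auto intro!: borel_measurable_diff clip_mb_measurable measurable_compose[OF _ F_measurable])
qed

lemma drift_measurable: "idx k \<subseteq> J \<Longrightarrow> drift k \<in> borel_measurable (samples J)"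
proof (induction k)
  case (Suc k)
  then show ?case unfolding drift_Suc[abs_def] using err_measurable(2)[OF Suc.prems]
    by (intro borel_measurable_add borel_measurable_scaleR) (auto simp: idx_Suc)
qed (simp add: drift_def[abs_def])

lemma pot_measurable: "idx k \<subseteq> J \<Longrightarrow> pot k \<in> borel_measurable (samples J)"
proof (induction k)
  case (Suc k)
  have [measurable]: "pot k \<in> borel_measurable (samples J)" using Suc by (auto simp: idx_Suc)
  have [measurable]: "drift k \<in> borel_measurable (samples J)"
    by (rule drift_measurable) (use Suc.prems in \<open>auto simp: idx_Suc\<close>)
  have [measurable]: "xt k \<in> borel_measurable (samples J)"
    by (rule xt_measurable) (use Suc.prems in \<open>auto simp: idx_Suc\<close>)
  note [measurable] = err_measurable[OF Suc.prems]
  show ?case unfolding pot.simps(2)[abs_def] increment_def by measurable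
qed (simp add: pot.simps(1)[abs_def])

section \<open>Conditional exponential moments of one step\<close>

lemma mb_moments:
  assumes x: "norm (x - xs) \<le> 3 * R"
  shows "integrable (samples (batch s k)) (\<lambda>z. mb s k z x)"
    and "(\<integral>z. mb s k z x \<partial>samples (batch s k)) = F x"
    and "integrable (samples (batch s k)) (\<lambda>z. (norm (mb s k z x - F x))\<^sup>2)"
    and "(\<integral>z. (norm (mb s k z x - F x))\<^sup>2 \<partial>samples (batch s k)) \<le> \<sigma>\<^sup>2 / real m"
proof -
  have D: "prob_space D" by unfold_locales
  have i: "integrable D (\<lambda>\<zeta>. G \<zeta> x)" and F: "(\<integral>\<zeta>. G \<zeta> x \<partial>D) = F x"
    using unbiased[of x] by (auto simp: has_bochner_integral_iff)
  have v: "(\<integral>\<^sup>+\<zeta>. ennreal ((norm (G \<zeta> x - F x))\<^sup>2) \<partial>D) \<le> ennreal (\<sigma>\<^sup>2)"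
    using x R_pos by (intro bounded_variance) (simp add: dist_norm norm_minus_commute)
  note mean = minibatch_mean[OF D finite_batch batch_nonempty i, of s k, unfolded F]
  note var = minibatch_variance[OF D finite_batch batch_nonempty i _ v[folded F], of s k, unfolded F]
  show "integrable (samples (batch s k)) (\<lambda>z. mb s k z x)" unfolding mb_def by (rule mean)
  show "(\<integral>z. mb s k z x \<partial>samples (batch s k)) = F x" unfolding mb_def by (rule mean)
  show "integrable (samples (batch s k)) (\<lambda>z. (norm (mb s k z x - F x))\<^sup>2)"
    unfolding mb_def by (rule var) simp
  show "(\<integral>z. (norm (mb s k z x - F x))\<^sup>2 \<partial>samples (batch s k)) \<le> \<sigma>\<^sup>2 / real m"
    unfolding mb_def using var(2) by (simp add: card_batch)
qed

lemma prob_space_samples: "prob_space (samples J)"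
  by (rule prob_space_PiM) unfold_locales

definition t where "t = A / R\<^sup>2"

lemma t_pos: "t > 0" using A_ge_1 R_pos by (simp add: t_def)

definition c where "c = t * \<gamma>\<^sup>2 * A"

lemma c_nonneg: "c \<ge> 0" using A_ge_1 t_pos by (simp add: c_def)

text \<open>A bound for the conditional expectation of \<open>exp (t * pot (Suc k) y)\<close>, given all samples before
  the second minibatch of iteration \<open>k\<close>.\<close>

definition after_extrapolation where
  "after_extrapolation k y = exp (t * pot k y) * (if pot k y \<le> 4 * R\<^sup>2
     then 1 + c * (312 * \<sigma>\<^sup>2 / real m + 9 * (norm (mb 1 k y (xk k y) - F (xk k y)))\<^sup>2) else 1)"

text \<open>With the earlier samples \<open>y\<close> held fixed, only the second minibatch varies;
  \<open>merge\<close> glues it to \<open>y\<close>. In a frozen state the integrand is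
  constant.\<close>

lemma nn_integral_update:
  fixes k :: nat
  defines "J \<equiv> idx k \<union> batch 1 k"
  shows "(\<integral>\<^sup>+z. ennreal (exp (t * pot (Suc k) (merge J (batch 2 k) (y, z)))) \<partial>samples (batch 2 k))
     \<le> ennreal (after_extrapolation k y)"
proof -
  interpret P: prob_space "samples (batch 2 k)" by (rule prob_space_samples)
  define q where "q z = merge J (batch 2 k) (y, z)" for z
  have qJ: "q z j = y j" if "j \<in> J" for z j using that by (simp add: q_def merge_def)
  have q2: "q z j = z j" if "j \<in> batch 2 k" for z j
    using that idx_disjoint(2)[of k] by (auto simp: q_def merge_def J_def)
  have pot: "pot k (q z) = pot k y" for z by (rule pot_cong) (simp add: qJ J_def)
  have xk: "xk k (q z) = xk k y" for z by (rule xk_cong) (simp add: qJ J_def)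
  have xt: "xt k (q z) = xt k y" for z by (rule xt_cong) (simp add: qJ J_def)
  have dr: "drift k (q z) = drift k y" for z by (rule drift_cong) (simp add: qJ J_def)
  have m1: "mb 1 k (q z) x = mb 1 k y x" for z x by (rule mb_cong) (simp add: qJ J_def)
  have m2: "mb 2 k (q z) x = mb 2 k z x" for z x by (rule mb_cong) (simp add: q2)
  show ?thesis
  proof (cases "pot k y \<le> 4 * R\<^sup>2")
    case False
    then show ?thesis unfolding q_def[symmetric] pot.simps pot
      by (simp add: after_extrapolation_def P.emeasure_space_1)
  next
    case True
    note near = good_near[OF True]
    define w where "w = xt k y - xs + drift k y"
    define f1 where "f1 = F (xk k y)"
    define f2 where "f2 = F (xt k y)"
    define Y1 where "Y1 = mb 1 k y (xk k y)"
    define Y2 where "Y2 z = mb 2 k z (xt k y)" for z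
    have f1: "norm f1 \<le> lam / 2" unfolding f1_def by (rule F_bounded) (use near R_pos in simp)
    have f2: "norm f2 \<le> lam / 2" unfolding f2_def by (rule F_bounded) (use near R_pos in simp)
    \<comment> \<open>The majorant from \<open>exp_noise_le\<close>. It is integrated as a real
      function, because the cancellation concerns its signed linear term.\<close>
    define g where "g z = exp (t * pot k y) * (1 + 2 * t * \<gamma> * ((f2 - Y2 z) \<bullet> w)
        + c * (312 * (norm (Y2 z - f2))\<^sup>2 + 9 * (norm (Y1 - f1))\<^sup>2))" for z
    have le: "exp (t * pot (Suc k) (q z)) \<le> g z" for z
    proof -
      have "exp (t * pot (Suc k) (q z)) = exp (t * pot k y) * exp (t * increment k (q z))"
        using True by (simp add: pot pot.simps(2) distrib_left exp_add)
      also have "\<dots> \<le> g z"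
        unfolding g_def increment_def err1_def err2_def xk xt dr m1 m2 t_def c_def f1_def f2_def Y1_def Y2_def w_def
        by (intro mult_left_mono exp_noise_le A_ge_1 R_pos \<gamma>_pos clipping_level f1[unfolded f1_def] f2[unfolded f2_def] near) simp
      finally show ?thesis .
    qed
    note mm = mb_moments[OF near(2), of 2 k, folded Y2_def f2_def]
    have i1: "integrable (samples (batch 2 k)) (\<lambda>z. (f2 - Y2 z) \<bullet> w)"
      using mm(1) by (intro integrable_inner_left Bochner_Integration.integrable_diff) auto
    have int: "integrable (samples (batch 2 k)) g"
      unfolding g_def using i1 mm(3)
      by (intro integrable_mult_right Bochner_Integration.integrable_add) auto
    \<comment> \<open>The martingale cancellation: \<open>w\<close> is determined by the earlier
      samples and the minibatch has mean \<open>f2\<close>.\<close>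
    have "(\<integral>z. (f2 - Y2 z) \<bullet> w \<partial>samples (batch 2 k)) = 0"
      using mm(1,2) by (simp add: P.prob_space)
    then have "(\<integral>z. g z \<partial>samples (batch 2 k)) = exp (t * pot k y) * (1
        + c * (312 * (\<integral>z. (norm (Y2 z - f2))\<^sup>2 \<partial>samples (batch 2 k)) + 9 * (norm (Y1 - f1))\<^sup>2))"
      unfolding g_def using i1 mm(3) by (simp add: P.prob_space)
    also have "\<dots> \<le> exp (t * pot k y) * (1 + c * (312 * (\<sigma>\<^sup>2 / real m) + 9 * (norm (Y1 - f1))\<^sup>2))"
      using mm(4) c_nonneg by (intro mult_left_mono add_mono) auto
    also have "\<dots> = after_extrapolation k y"
      using True by (simp add: after_extrapolation_def Y1_def f1_def)
    finally have gi: "(\<integral>z. g z \<partial>samples (batch 2 k)) \<le> after_extrapolation k y" .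
    have "(\<integral>\<^sup>+z. ennreal (exp (t * pot (Suc k) (q z))) \<partial>samples (batch 2 k)) \<le> (\<integral>\<^sup>+z. ennreal (g z) \<partial>samples (batch 2 k))"
      using le by (intro nn_integral_mono ennreal_leI)
    \<comment> \<open>\<open>g\<close> is nonnegative because it dominates an exponential.\<close>
    also have "\<dots> = ennreal (\<integral>z. g z \<partial>samples (batch 2 k))"
      using le by (intro nn_integral_eq_integral int) (auto intro: order_trans[OF exp_ge_zero])
    also have "\<dots> \<le> ennreal (after_extrapolation k y)" using gi by (rule ennreal_leI)
    finally show ?thesis by (simp add: q_def)
  qed
qed

text \<open>Integrating out the first minibatch replaces its squared error by the variance bound;
  321 = 312 + 9. A frozen state only needs the last factor to be at least 1.\<close>

lemma nn_integral_extrapolation: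
  "(\<integral>\<^sup>+z. ennreal (after_extrapolation k (merge (idx k) (batch 1 k) (y, z))) \<partial>samples (batch 1 k))
     \<le> ennreal (exp (t * pot k y) * (1 + 321 * c * \<sigma>\<^sup>2 / real m))"
proof -
  interpret P: prob_space "samples (batch 1 k)" by (rule prob_space_samples)
  define q where "q z = merge (idx k) (batch 1 k) (y, z)" for z
  have qJ: "q z j = y j" if "j \<in> idx k" for z j using that by (simp add: q_def merge_def)
  have q1: "q z j = z j" if "j \<in> batch 1 k" for z j
    using that idx_disjoint(1)[of k 1] by (auto simp: q_def merge_def)
  have pot: "pot k (q z) = pot k y" for z by (rule pot_cong) (simp add: qJ)
  have xk: "xk k (q z) = xk k y" for z by (rule xk_cong) (simp add: qJ)
  have m1: "mb 1 k (q z) x = mb 1 k z x" for z x by (rule mb_cong) (simp add: q1)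
  show ?thesis
  proof (cases "pot k y \<le> 4 * R\<^sup>2")
    case False
    then show ?thesis unfolding q_def[symmetric] after_extrapolation_def pot
      using c_nonneg by (simp add: P.emeasure_space_1 ennreal_leI)
  next
    case True
    define g where "g z = exp (t * pot k y)
      * (1 + c * (312 * \<sigma>\<^sup>2 / real m + 9 * (norm (mb 1 k z (xk k y) - F (xk k y)))\<^sup>2))" for z
    have eq: "after_extrapolation k (q z) = g z" for z
      using True by (simp add: after_extrapolation_def pot xk m1 g_def)
    have x: "norm (xk k y - xs) \<le> 3 * R" using good_near(1)[OF True] R_pos by simp
    note mm = mb_moments[OF x, of 1 k]
    have int: "integrable (samples (batch 1 k)) g"
      unfolding g_def using mm(3)
      by (intro integrable_mult_right Bochner_Integration.integrable_add) auto
    have "(\<integral>z. g z \<partial>samples (batch 1 k)) = exp (t * pot k y) * (1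
        + c * (312 * \<sigma>\<^sup>2 / real m + 9 * (\<integral>z. (norm (mb 1 k z (xk k y) - F (xk k y)))\<^sup>2 \<partial>samples (batch 1 k))))"
      unfolding g_def using mm(3) by (simp add: P.prob_space)
    also have "\<dots> \<le> exp (t * pot k y) * (1 + c * (312 * \<sigma>\<^sup>2 / real m + 9 * (\<sigma>\<^sup>2 / real m)))"
      using mm(4) c_nonneg by (intro mult_left_mono add_mono) auto
    also have "\<dots> = exp (t * pot k y) * (1 + 321 * c * \<sigma>\<^sup>2 / real m)" by (simp add: field_simps)
    finally have gi: "(\<integral>z. g z \<partial>samples (batch 1 k)) \<le> \<dots>" .
    have "(\<integral>\<^sup>+z. ennreal (g z) \<partial>samples (batch 1 k)) = ennreal (\<integral>z. g z \<partial>samples (batch 1 k))"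
      using c_nonneg by (intro nn_integral_eq_integral int) (simp add: g_def)
    also have "\<dots> \<le> ennreal (exp (t * pot k y) * (1 + 321 * c * \<sigma>\<^sup>2 / real m))"
      using gi by (rule ennreal_leI)
    finally show ?thesis by (simp add: eq flip: q_def)
  qed
qed

text \<open>The batch size is tied to the horizon so that a step multiplies the moment by at most
  \<open>1 + A / (K + 1)\<close>, and \<open>K + 1\<close> steps by at most
  \<open>exp A\<close>.\<close>

lemma variance_term_le: "321 * c * \<sigma>\<^sup>2 / real m \<le> A / (real K + 1)"
proof -
  define S where "S = (real K + 1) * \<gamma>\<^sup>2 * \<sigma>\<^sup>2 * A / R\<^sup>2"
  have "S \<ge> 0" using A_ge_1 by (simp add: S_def)
  have "321 * S \<le> 10800 * S" using \<open>S \<ge> 0\<close> by simp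
  also have "10800 * S \<le> real m" using batchsize unfolding S_def by (simp only: mult.assoc times_divide_eq_right)
  finally have "321 * S / real m \<le> 1" using m_pos by simp
  then have "A / (real K + 1) * (321 * S / real m) \<le> A / (real K + 1) * 1"
    using A_ge_1 by (intro mult_left_mono) auto
  moreover have "A / n * (321 * (n * \<gamma>\<^sup>2 * \<sigma>\<^sup>2 * A / R\<^sup>2) / real m) = 321 * c * \<sigma>\<^sup>2 / real m"
    if "n \<noteq> 0" for n
    using that by (simp add: c_def t_def field_simps)
  from this[of "real K + 1"] have "A / (real K + 1) * (321 * S / real m) = 321 * c * \<sigma>\<^sup>2 / real m"
    by (simp add: S_def)
  ultimately show ?thesis by simp
qed

lemma after_extrapolation_measurable:
  "after_extrapolation k \<in> borel_measurable (samples (idx k \<union> batch 1 k))"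
proof -
  let ?J = "idx k \<union> batch 1 k"
  have [measurable]: "pot k \<in> borel_measurable (samples ?J)" by (rule pot_measurable) simp
  have [measurable]: "xk k \<in> borel_measurable (samples ?J)" by (rule xk_measurable) simp
  have [measurable]: "(\<lambda>y. mb 1 k y (xk k y)) \<in> borel_measurable (samples ?J)"
    by (rule mb_measurable) auto
  show ?thesis unfolding after_extrapolation_def[abs_def] by measurable
qed

text \<open>The tower property as two applications of Fubini. The second minibatch is integrated
  first, since the extrapolated point depends on the first one.\<close>

lemma nn_integral_pot_Suc:
  "(\<integral>\<^sup>+y. ennreal (exp (t * pot (Suc k) y)) \<partial>samples (idx (Suc k)))
    \<le> ennreal (1 + A / (real K + 1)) * (\<integral>\<^sup>+y. ennreal (exp (t * pot k y)) \<partial>samples (idx k))"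
proof -
  interpret P: product_prob_space "\<lambda>_. D" "idx k" by unfold_locales
  let ?J = "idx k \<union> batch 1 k"
  have [measurable]: "pot (Suc k) \<in> borel_measurable (samples (?J \<union> batch 2 k))"
    by (rule pot_measurable) (simp add: idx_Suc)
  note [measurable] = after_extrapolation_measurable pot_measurable[OF order_refl]
  have "(\<integral>\<^sup>+y. ennreal (exp (t * pot (Suc k) y)) \<partial>samples (idx (Suc k)))
     = (\<integral>\<^sup>+y. \<integral>\<^sup>+z. ennreal (exp (t * pot (Suc k) (merge ?J (batch 2 k) (y, z)))) \<partial>samples (batch 2 k) \<partial>samples ?J)"
    unfolding idx_Suc using idx_disjoint(2)[of k]
    by (subst P.product_nn_integral_fold) auto
  also have "\<dots> \<le> (\<integral>\<^sup>+y. ennreal (after_extrapolation k y) \<partial>samples ?J)"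
    by (intro nn_integral_mono nn_integral_update)
  also have "\<dots> = (\<integral>\<^sup>+y. \<integral>\<^sup>+z. ennreal (after_extrapolation k (merge (idx k) (batch 1 k) (y, z)))
      \<partial>samples (batch 1 k) \<partial>samples (idx k))"
    using idx_disjoint(1)[of k 1] by (subst P.product_nn_integral_fold) auto
  also have "\<dots> \<le> (\<integral>\<^sup>+y. ennreal (1 + A / (real K + 1)) * ennreal (exp (t * pot k y)) \<partial>samples (idx k))"
  proof (rule nn_integral_mono)
    fix y
    note nn_integral_extrapolation[of k y]
    also have "ennreal (exp (t * pot k y) * (1 + 321 * c * \<sigma>\<^sup>2 / real m))
      \<le> ennreal (exp (t * pot k y) * (1 + A / (real K + 1)))"
      using variance_term_le by (intro ennreal_leI mult_left_mono) auto
    also have "\<dots> = ennreal (1 + A / (real K + 1)) * ennreal (exp (t * pot k y))"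
      using A_ge_1 by (subst ennreal_mult[symmetric]) (auto simp: mult.commute)
    finally show "(\<integral>\<^sup>+z. ennreal (after_extrapolation k (merge (idx k) (batch 1 k) (y, z))) \<partial>samples (batch 1 k))
      \<le> \<dots>" .
  qed
  also have "\<dots> = ennreal (1 + A / (real K + 1)) * (\<integral>\<^sup>+y. ennreal (exp (t * pot k y)) \<partial>samples (idx k))"
    by (rule nn_integral_cmult) measurable
  finally show ?thesis .
qed

section \<open>Moment bound and Markov's inequality\<close>

lemma nn_integral_pot:
  "(\<integral>\<^sup>+y. ennreal (exp (t * pot k y)) \<partial>samples (idx k)) \<le> ennreal (exp A * (1 + A / (real K + 1)) ^ k)"
proof (induction k)
  case 0
  interpret P: prob_space "samples (idx 0)" by (rule prob_space_samples)
  \<comment> \<open>The starting value gives \<open>exp (t * R\<^sup>2) = exp A\<close>.\<close>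
  show ?case using R_pos by (simp add: t_def P.emeasure_space_1)
next
  case (Suc k)
  note nn_integral_pot_Suc[of k]
  also have "ennreal (1 + A / (real K + 1)) * (\<integral>\<^sup>+y. ennreal (exp (t * pot k y)) \<partial>samples (idx k))
    \<le> ennreal (1 + A / (real K + 1)) * ennreal (exp A * (1 + A / (real K + 1)) ^ k)"
    by (intro mult_left_mono Suc) simp
  also have "\<dots> = ennreal (exp A * (1 + A / (real K + 1)) ^ Suc k)"
    using A_ge_1 by (subst ennreal_mult[symmetric]) (auto simp: mult_ac)
  finally show ?case .
qed

lemma prob_good:
  "measure (samples (idx (Suc K))) {y \<in> space (samples (idx (Suc K))). pot (Suc K) y \<le> 4 * R\<^sup>2} \<ge> 1 - exp (- 2 * A)"
proof -
  let ?P = "samples (idx (Suc K))"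
  interpret P: prob_space ?P by (rule prob_space_samples)
  have [measurable]: "pot (Suc K) \<in> borel_measurable ?P" by (rule pot_measurable) simp
  define B where "B = {y \<in> space ?P. \<not> pot (Suc K) y \<le> 4 * R\<^sup>2}"
  have B[measurable]: "B \<in> sets ?P" unfolding B_def by measurable
  have growth: "(1 + A / (real K + 1)) ^ Suc K \<le> exp A"
  proof -
    have "(1 + A / (real K + 1)) ^ Suc K \<le> exp (A / (real K + 1)) ^ Suc K"
      using A_ge_1 by (intro power_mono exp_ge_add_one_self) auto
    also have "\<dots> = exp A" by (subst exp_of_nat_mult[symmetric]) (simp add: add.commute)
    finally show ?thesis .
  qed
  have t4: "t * (4 * R\<^sup>2) = 4 * A" using R_pos by (simp add: t_def)
  have "emeasure ?P B = (\<integral>\<^sup>+y. indicator B y \<partial>?P)" by simp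
  \<comment> \<open>Exponential Markov inequality at the level \<open>4 * R\<^sup>2\<close>, whose
    multiple by \<open>t\<close> is \<open>4 * A\<close>.\<close>
  also have "\<dots> \<le> (\<integral>\<^sup>+y. ennreal (exp (- 4 * A)) * ennreal (exp (t * pot (Suc K) y)) \<partial>?P)"
  proof (rule nn_integral_mono)
    fix y
    show "indicator B y \<le> ennreal (exp (- 4 * A)) * ennreal (exp (t * pot (Suc K) y))"
    proof (cases "y \<in> B")
      case True
      then have "4 * R\<^sup>2 \<le> pot (Suc K) y" by (simp add: B_def)
      then have "4 * A \<le> t * pot (Suc K) y"
        using t_pos mult_left_mono[of "4 * R\<^sup>2" "pot (Suc K) y" t] unfolding t4 by simp
      then have "ennreal 1 \<le> ennreal (exp (- 4 * A) * exp (t * pot (Suc K) y))"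
        by (intro ennreal_leI) (simp flip: exp_add)
      then show ?thesis using True by (simp add: ennreal_mult)
    qed simp
  qed
  also have "\<dots> = ennreal (exp (- 4 * A)) * (\<integral>\<^sup>+y. ennreal (exp (t * pot (Suc K) y)) \<partial>?P)"
    by (rule nn_integral_cmult) measurable
  also have "\<dots> \<le> ennreal (exp (- 4 * A)) * ennreal (exp A * (1 + A / (real K + 1)) ^ Suc K)"
    by (intro mult_left_mono nn_integral_pot) simp
  also have "\<dots> \<le> ennreal (exp (- 4 * A)) * ennreal (exp A * exp A)"
    using growth by (intro mult_left_mono ennreal_leI) auto
  also have "\<dots> = ennreal (exp (- 2 * A))"
    by (simp flip: ennreal_mult exp_add)
  finally have "measure ?P B \<le> exp (- 2 * A)" by (simp add: P.emeasure_eq_measure)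
  moreover have "{y \<in> space ?P. pot (Suc K) y \<le> 4 * R\<^sup>2} = space ?P - B" by (auto simp: B_def)
  ultimately show ?thesis by (simp add: P.prob_compl)
qed

section \<open>Transfer to the given probability space\<close>

text \<open>An intersection of closed sets is closed even over uncountably many \<open>y\<close>, so
  the sublevel set is closed.\<close>

lemma gap_sublevel_borel: "{x. Gap F xs R x \<le> b} \<in> sets borel"
proof -
  \<comment> \<open>Boundedness above makes the real supremum a genuine least upper bound.\<close>
  have bdd: "bdd_above ((\<lambda>y. F y \<bullet> (x - y)) ` cball xs R)" for x
  proof (rule bdd_aboveI2)
    fix y assume "y \<in> cball xs R"
    then have y: "norm (y - xs) \<le> R" by (simp add: dist_norm norm_minus_commute)
    have "F y \<bullet> (x - y) \<le> norm (F y) * norm (x - y)" by (rule norm_cauchy_schwarz)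
    also have "\<dots> \<le> (lam / 2) * (norm (x - xs) + R)"
    proof (rule mult_mono)
      show "norm (F y) \<le> lam / 2" using F_bounded[of y] y R_pos by simp
      show "norm (x - y) \<le> norm (x - xs) + R"
        using norm_triangle_ineq4[of "x - xs" "y - xs"] y by simp
    qed (use lam_pos in auto)
    finally show "F y \<bullet> (x - y) \<le> (lam / 2) * (norm (x - xs) + R)" .
  qed
  have "{x. Gap F xs R x \<le> b} = (\<Inter>y\<in>cball xs R. {x. F y \<bullet> (x - y) \<le> b})"
    unfolding Gap_def using R_pos by (auto simp: cSUP_le_iff[OF _ bdd])
  also have "closed \<dots>"
    by (intro closed_INT ballI closed_Collect_le continuous_intros)
  finally show ?thesis by (rule borel_closed)
qed

text \<open>Independence and identical distribution make the joint law of the samples the product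
  measure on which \<open>prob_good\<close> was proved; the event is pulled back along the sample
  map.\<close>

lemma gap_prob:
  fixes M :: "'w measure" and \<xi> :: "nat \<Rightarrow> nat \<Rightarrow> nat \<Rightarrow> 'w \<Rightarrow> 'b"
  assumes "prob_space M"
    and indep: "prob_space.indep_vars M (\<lambda>_. D) (\<lambda>(s, k, i). \<xi> s k i) ({1, 2} \<times> {0..K} \<times> {1..m})"
    and dist: "\<And>s k i. s \<in> {1, 2} \<Longrightarrow> k \<in> {0..K} \<Longrightarrow> i \<in> {1..m} \<Longrightarrow> distr M D (\<xi> s k i) = D"
  shows "1 - exp (- 2 * A) \<le> \<P>(\<omega> in M. Gap F xs R
      (clipped_SEG_tilde_avg G x0 \<gamma> \<gamma> (\<lambda>_. lam) (\<lambda>_. lam) (\<lambda>_. m) (\<lambda>_. m) (\<lambda>s k i. \<xi> s k i \<omega>) K)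
      \<le> 9 * R\<^sup>2 / (2 * \<gamma> * (real K + 1)))"
proof -
  interpret M: prob_space M by fact
  let ?J = "idx (Suc K)"
  let ?S = "\<lambda>(s, k, i). \<xi> s k i"
  let ?b = "9 * R\<^sup>2 / (2 * \<gamma> * (real K + 1))"
  have J: "{1, 2} \<times> {0..K} \<times> {1..m} = ?J" by (auto simp: idx_def)
  have rv: "?S j \<in> measurable M D" if "j \<in> ?J" for j
    using indep that unfolding J by (simp add: M.indep_vars_def)
  have dj: "distr M D (?S j) = D" if "j \<in> ?J" for j using that dist unfolding J[symmetric] by auto
  \<comment> \<open>Restriction makes \<open>W\<close> take values in the product space; its default
    value outside the index set is invisible by \<open>xt_cong\<close>.\<close>
  define W where "W \<omega> = (\<lambda>j\<in>?J. ?S j \<omega>)" for \<omega>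
  have W[measurable]: "W \<in> measurable M (samples ?J)"
    unfolding W_def[abs_def] by (intro measurable_restrict rv)
  \<comment> \<open>Characterising independence by the joint law requires a nonempty index
    set.\<close>
  have ne: "?J \<noteq> {}" using m_pos by (force simp: idx_def)
  have "distr M (samples ?J) W = Pi\<^sub>M ?J (\<lambda>j. distr M D (?S j))"
    using indep rv unfolding J W_def[abs_def] by (subst (asm) M.indep_vars_iff_distr_eq_PiM'[OF ne]) auto
  also have "\<dots> = samples ?J" by (intro PiM_cong refl dj)
  finally have dW: "distr M (samples ?J) W = samples ?J" .
  define avg where "avg y = (1 / (real K + 1)) *\<^sub>R (\<Sum>k=0..K. xt k y)" for y
  have [measurable]: "avg \<in> borel_measurable (samples ?J)"
    unfolding avg_def[abs_def]
  proof (intro borel_measurable_scaleR borel_measurable_sum xt_measurable)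
    fix k assume "k \<in> {0..K}"
    then show "idx k \<union> batch 1 k \<subseteq> ?J" using idx_mono[of k "Suc K"] batch_subset_idx[of 1 k "Suc K"] by auto
  qed simp
  have avg: "clipped_SEG_tilde_avg G x0 \<gamma> \<gamma> (\<lambda>_. lam) (\<lambda>_. lam) (\<lambda>_. m) (\<lambda>_. m) (\<lambda>s k i. \<xi> s k i \<omega>) K
     = avg (W \<omega>)" for \<omega>
  proof -
    have "xt k (\<lambda>j. ?S j \<omega>) = xt k (W \<omega>)" if "k \<le> K" for k
    proof (rule xt_cong)
      fix j assume "j \<in> idx k \<union> batch 1 k"
      then have "j \<in> ?J" using idx_mono[of k "Suc K"] batch_subset_idx[of 1 k "Suc K"] that by auto
      then show "?S j \<omega> = W \<omega> j" by (simp add: W_def)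
    qed
    then show ?thesis by (simp add: clipped_SEG_tilde_avg_def avg_def xt_def)
  qed
  \<comment> \<open>The gap event must be measurable both for monotonicity of the measure and for
    the image measure formula.\<close>
  have meas: "{y \<in> space (samples ?J). Gap F xs R (avg y) \<le> ?b} \<in> sets (samples ?J)"
    using measurable_sets[OF \<open>avg \<in> borel_measurable (samples ?J)\<close> gap_sublevel_borel[of ?b]]
    by (simp add: vimage_def Int_def conj_commute)
  interpret P: prob_space "samples ?J" by (rule prob_space_samples)
  have "1 - exp (- 2 * A) \<le> measure (samples ?J) {y \<in> space (samples ?J). pot (Suc K) y \<le> 4 * R\<^sup>2}"
    by (rule prob_good)
  also have "\<dots> \<le> measure (samples ?J) {y \<in> space (samples ?J). Gap F xs R (avg y) \<le> ?b}"
    by (intro P.finite_measure_mono meas) (use gap_le_of_good avg_def in auto)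
  also have "\<dots> = measure (distr M (samples ?J) W) {y \<in> space (samples ?J). Gap F xs R (avg y) \<le> ?b}"
    by (simp add: dW)
  also have "\<dots> = measure M (W -` {y \<in> space (samples ?J). Gap F xs R (avg y) \<le> ?b} \<inter> space M)"
    by (rule measure_distr[OF W meas])
  also have "W -` {y \<in> space (samples ?J). Gap F xs R (avg y) \<le> ?b} \<inter> space M
     = {\<omega> \<in> space M. Gap F xs R (avg (W \<omega>)) \<le> ?b}"
    using measurable_space[OF W] by auto
  finally show ?thesis by (simp add: avg)
qed

end

theorem theoremC1:
  fixes F :: "real ^ 'd \<Rightarrow> real ^ 'd"
    and G :: "'b \<Rightarrow> real ^ 'd \<Rightarrow> real ^ 'd"
    and D :: "'b measure" and M :: "'w measure"
    and \<xi> :: "nat \<Rightarrow> nat \<Rightarrow> nat \<Rightarrow> 'w \<Rightarrow> 'b"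
    and x0 xs :: "real ^ 'd"
    and R \<sigma> L \<gamma> lam \<beta> :: real and m K :: nat
  assumes "prob_space D" and "prob_space M"
    and oracle_measurable: "(\<lambda>(\<zeta>, x). G \<zeta> x) \<in> borel_measurable (D \<Otimes>\<^sub>M borel)"
    and unbiased: "\<And>x. has_bochner_integral D (\<lambda>\<zeta>. G \<zeta> x) (F x)"
    and samples_indep: "prob_space.indep_vars M (\<lambda>_. D) (\<lambda>(s, k, i). \<xi> s k i)
          ({1, 2} \<times> {0..K} \<times> {1..m})"
    and samples_distr: "\<And>s k i. s \<in> {1, 2} \<Longrightarrow> k \<in> {0..K} \<Longrightarrow> i \<in> {1..m} \<Longrightarrow>
          distr M D (\<xi> s k i) = D"
    and projection: "is_projection {x. F x = 0} x0 xs"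
    and "R > 0" and "R \<ge> norm (x0 - xs)"
    and bounded_variance: "\<And>x. x \<in> cball xs (4 * R) \<Longrightarrow>
          (\<integral>\<^sup>+ \<zeta>. ennreal ((norm (G \<zeta> x - F x))\<^sup>2) \<partial>D) \<le> ennreal (\<sigma>\<^sup>2)"
    and lipschitz: "L-lipschitz_on (cball xs (4 * R)) F"
    and monotone: "\<And>x y. x \<in> cball xs (4 * R) \<Longrightarrow> y \<in> cball xs (4 * R) \<Longrightarrow>
          (F x - F y) \<bullet> (x - y) \<ge> 0"
    and "0 < \<beta>" and "\<beta> \<le> 1" and "ln (6 * (real K + 1) / \<beta>) \<ge> 1"
    and "0 < \<gamma>"
    and stepsize: "L > 0 \<Longrightarrow> \<gamma> \<le> 1 / (160 * L * ln (6 * (real K + 1) / \<beta>))"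
    and clipping_level: "lam = R / (20 * \<gamma> * ln (6 * (real K + 1) / \<beta>))"
    and batchsize: "real m \<ge> max 1
          (10800 * (real K + 1) * \<gamma>\<^sup>2 * \<sigma>\<^sup>2 * ln (6 * (real K + 1) / \<beta>) / R\<^sup>2)"
  shows "\<P>(\<omega> in M.
            Gap F xs R
              (clipped_SEG_tilde_avg G x0 \<gamma> \<gamma> (\<lambda>_. lam) (\<lambda>_. lam) (\<lambda>_. m) (\<lambda>_. m)
                (\<lambda>s k i. \<xi> s k i \<omega>) K)
            \<le> 9 * R\<^sup>2 / (2 * \<gamma> * (real K + 1)))
         \<ge> 1 - \<beta>"
proof -
  define A where "A = ln (6 * (real K + 1) / \<beta>)"
  have A: "A \<ge> 1" using assms unfolding A_def by simp
  have "0 \<le> L" using lipschitz by (rule lipschitz_on_nonneg)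
  \<comment> \<open>For \<open>L = 0\<close> the left side is zero; for positive \<open>L\<close>
    this is the step size bound with the denominator cleared.\<close>
  have step: "160 * (L * \<gamma> * A) \<le> 1"
  proof (cases "L > 0")
    case True
    then show ?thesis using stepsize[folded A_def] A by (simp add: field_simps)
  qed (use \<open>0 \<le> L\<close> in simp)
  interpret D: prob_space D by fact
  interpret clipped_SEG_analysis D F G x0 xs R \<sigma> L \<gamma> lam A m K
  proof (intro clipped_SEG_analysis.intro clipped_SEG_analysis_axioms.intro)
    show "F xs = 0" using projection by (simp add: is_projection_def)
    show "0 < m" using batchsize by simp
    show "10800 * (real K + 1) * \<gamma>\<^sup>2 * \<sigma>\<^sup>2 * A / R\<^sup>2 \<le> real m" using batchsize[folded A_def] by simp
    show "lam = R / (20 * \<gamma> * A)" using clipping_level[folded A_def] .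
  qed fact+
  \<comment> \<open>The choice of \<open>A\<close> converts the exponential tail into the confidence
    level.\<close>
  have "exp (- 2 * A) \<le> exp (- A)" using A by simp
  also have "\<dots> = \<beta> / (6 * (real K + 1))"
    using \<open>0 < \<beta>\<close> by (simp add: A_def exp_minus)
  also have "\<dots> \<le> \<beta>" using \<open>0 < \<beta>\<close> by (simp add: field_simps)
  finally show ?thesis using gap_prob[OF assms(2) samples_indep samples_distr] by linarith
qed

end
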